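(* Let $G$ be a chordiagraph with vertex set $V_G$ and adjacency matrix $\mathfrak{e}$, all of whose vertices have even degree, and let $\mathfrak{r}=\mathfrak{e}+\mathfrak{e}^2$ (modulo $2$) be its Rosenstiehl form. (1) For every chord diagram $C$ with interlace graph $G$, the minimal genus among all framings of $C$ equals $$\mathrm{mg}(\mathfrak{e})=\tfrac12\min\{\operatorname{rank}(\mathfrak{r}+\mathfrak{c}_\chi)\mid \chi\colon V_G\to\{\bullet,\circ\}\},$$ where ranks are ranks of $V_G\times V_G$ matrices over $\mathbb{Z}/2$. (2) Suppose moreover that any two distinct non-adjacent vertices of $G$ have an even number of common neighbours. Then for every chord diagram $C$ with interlace graph $G$, the minimal genus among all framings of $C$ equals the minimum of the half-rank over the translate $\mathfrak{r}+B^1(G;\mathbb{Z}/2)$ of the space of coboundaries by the Rosenstiehl cocycle $\mathfrak{r}\in Z^1(G;\mathbb{Z}/2)$. Here the rank of a cochain in $Z^1(G;\mathbb{Z}/2)$ is the rank over $\mathbb{Z}/2$ of the symmetric $V_G\times V_G$ matrix which equals the cochain on edges of $G$ and $0$ on all other pairs.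
   Context: A chord diagram is a finite cyclic word $C$ in which every letter appears exactly twice, considered up to relabelling; its letters are called chords. A framing of $C$ is a function $\varphi\colon C\to\{0,\infty\}$ giving different values to the two occurrences of each letter; the occurrences of $x$ are then denoted $x_0,x_\infty$. Two chords are interlaced if their occurrences alternate along the cyclic word. The interlace graph $G$ of $C$ has vertex set $V_G$ the set of chords and edges the pairs of interlaced chords; a chordiagraph is a graph which is the interlace graph of some chord diagram. Graphs are finite and simple, with symmetric adjacency matrix $\mathfrak{e}\colon V_G\times V_G\to\{0,1\}$, zero on the diagonal. A filoop is a generic immersion $\gamma\colon\mathbb{S}^1\to F$ (all multiple points are transverse double points) in a smooth closed connected oriented surface such that $F\setminus\gamma$ is a disjoint union of discs, up to orientation preserving diffeomorphisms of source and target. Each double point $x$ has two preimages $x_\infty,x_0$ ordered so that $(\vec\gamma(x_\infty),\vec\gamma(x_0))$ (tangent vectors) is a positive basis of $T_xF$; reading the preimages along $\mathbb{S}^1$ gives a framed chord diagram. Every framed chord diagram $C_\varphi$ arises from a unique filoop: take for each chord $x$ an oriented disc with four disjoint boundary intervals labelled $x_\infty^+,x_0^+,x_\infty^-,x_0^-$ in this cyclic order; for every pair of consecutive occurrences $u,v$ in $C$ join $u^+$ to $v^-$ by an orientation-compatible band; glue discs to all boundary components to obtain $F$. The genus of the framing is the genus $g$ of $F$; if $C$ has $n$ chords and the ribbon graph has $f$ boundary components then $2-2g=f-n$. The Rosenstiehl form is the symmetric bilinear form $\mathfrak{r}=\mathfrak{e}+\mathfrak{e}^2\colon V_G\times V_G\to\mathbb{Z}/2$;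 its restriction to the edges is a $1$-cocycle $\mathfrak{r}\in Z^1(G;\mathbb{Z}/2)$, called the Rosenstiehl cocycle ($G$ is viewed as a $1$-dimensional complex, so every function on edges is a cocycle). $B^1(G;\mathbb{Z}/2)$ is the space of coboundaries. For $\chi\colon V_G\to\{\bullet,\circ\}$, the colour form $\mathfrak{c}_\chi\colon V_G\times V_G\to\{0,1\}$ is the differential on $G$ of the indicator function of $\chi^{-1}(\bullet)$ (or equivalently of $\chi^{-1}(\circ)$): $\mathfrak{c}_\chi(x,y)=1$ if $x,y$ are adjacent in $G$ and $\chi(x)\neq\chi(y)$, and $\mathfrak{c}_\chi(x,y)=0$ otherwise. *)

theory Defs
  imports
    Complex_Main
    "HOL-Library.Z2"
    "HOL-Library.Function_Algebras"
    "HOL-Combinatorics.Orbits"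
    "Graph_Theory.Graph_Theory"
begin

section \<open>Chord diagrams and interlace graphs\<close>

text \<open>
  A chord diagram is given by a list read cyclically: every notion below is invariant under
  rotation of the list, and an occurrence of a letter is a position \<open>i < length C\<close>.
  The empty list is the diagram without chords.
\<close>

definition chord_diagram :: "'b list \<Rightarrow> bool" where
  "chord_diagram C \<longleftrightarrow> (\<forall>x\<in>set C. count_list C x = 2)"

definition interlaced :: "'b list \<Rightarrow> 'b \<Rightarrow> 'b \<Rightarrow> bool" where
  "interlaced C x y \<longleftrightarrow> x \<noteq> y \<and>
     (\<exists>i j k l. i < j \<and> j < k \<and> k < l \<and> l < length C \<and>
        (C ! i = x \<and> C ! j = y \<and> C ! k = x \<and> C ! l = y \<or>
         C ! i = y \<and> C ! j = x \<and> C ! k = y \<and> C ! l = x))"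

text \<open>
  A finite simple graph is a \<open>pair_graph\<close>: finite, loopless, and with a symmetric arc relation.
\<close>

definition interlace_graph :: "'b list \<Rightarrow> 'b pair_pre_digraph" where
  "interlace_graph C = \<lparr> pverts = set C, parcs = {(x, y). interlaced C x y} \<rparr>"

lemma pair_graph_interlace_graph: "pair_graph (interlace_graph C)"
proof -
  have mem: "x \<in> set C \<and> y \<in> set C" if "interlaced C x y" for x y
    using that by (auto simp: interlaced_def)
  have sub: "parcs (interlace_graph C) \<subseteq> set C \<times> set C"
    using mem by (auto simp: interlace_graph_def)
  have sym: "interlaced C x y \<Longrightarrow> interlaced C y x" for x y
    unfolding interlaced_def by blast
  show ?thesis
  proof
    show "finite (parcs (interlace_graph C))"
      using sub by (rule finite_subset) simp
    show "symmetric (with_proj (interlace_graph C))"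
      using sym by (auto simp: symmetric_def interlace_graph_def intro!: symI)
  qed (use mem in \<open>auto simp: interlace_graph_def interlaced_def\<close>)
qed

text \<open>
  Chord diagrams are taken up to relabelling of the chords, so having interlace graph \<open>G\<close> is
  understood up to graph isomorphism; the chords need not have the type of the vertices.
\<close>

definition has_interlace_graph :: "'b list \<Rightarrow> 'a pair_pre_digraph \<Rightarrow> bool" where
  "has_interlace_graph C G \<longleftrightarrow> digraph_iso (with_proj (interlace_graph C)) (with_proj G)"

definition chordiagraph :: "'a pair_pre_digraph \<Rightarrow> bool" where
  "chordiagraph G \<longleftrightarrow> pair_graph G \<and> (\<exists>C :: 'a list. chord_diagram C \<and> has_interlace_graph C G)"

section \<open>Framings and their genus\<close>

datatype level = Zero | Infty

definition framing :: "'b list \<Rightarrow> (nat \<Rightarrow> level) \<Rightarrow> bool" where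
  "framing C \<phi> \<longleftrightarrow>
     (\<forall>i j. i < j \<and> j < length C \<and> C ! i = C ! j \<longrightarrow> \<phi> i \<noteq> \<phi> j)"

text \<open>
  The ribbon graph is encoded by two permutations of its half-edges. The half-edge \<open>(i, s)\<close> is the
  boundary interval with sign \<open>s\<close> of the disc of the chord \<open>C ! i\<close>, at the occurrence \<open>i\<close>.
\<close>

datatype sign = Pos | Neg

definition half_edges :: "'b list \<Rightarrow> (nat \<times> sign) set" where
  "half_edges C = {..<length C} \<times> UNIV"

definition other_occurrence :: "'b list \<Rightarrow> nat \<Rightarrow> nat" where
  "other_occurrence C i = (THE j. j < length C \<and> j \<noteq> i \<and> C ! j = C ! i)"

fun opposite :: "sign \<Rightarrow> sign" where
  "opposite Pos = Neg"
| "opposite Neg = Pos"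

text \<open>
  The next interval along the oriented boundary of a disc, for the cyclic order
  \<open>x\<^sub>\<infinity>\<^sup>+, x\<^sub>0\<^sup>+, x\<^sub>\<infinity>\<^sup>-, x\<^sub>0\<^sup>-\<close>.
\<close>

fun disc_next :: "'b list \<Rightarrow> (nat \<Rightarrow> level) \<Rightarrow> nat \<times> sign \<Rightarrow> nat \<times> sign" where
  "disc_next C \<phi> (i, s) =
     (other_occurrence C i, case \<phi> i of Infty \<Rightarrow> s | Zero \<Rightarrow> opposite s)"

text \<open>
  The band at the positive interval of an occurrence leads to the negative interval of the
  cyclically next occurrence.
\<close>

fun across_band :: "'b list \<Rightarrow> nat \<times> sign \<Rightarrow> nat \<times> sign" where
  "across_band C (i, Pos) = ((i + 1) mod length C, Neg)"
| "across_band C (i, Neg) = ((i + length C - 1) mod length C, Pos)"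

text \<open>
  The complement of the intervals in the boundary of the discs consists of one arc from each
  half-edge \<open>h\<close> to \<open>disc_next C \<phi> h\<close>. A boundary component of the ribbon graph that runs along this
  arc crosses over, along a side of the band attached at \<open>disc_next C \<phi> h\<close>, to the arc which
  starts at the other end of this band. Hence boundary components are orbits of the composition.
  Without chords the filoop is a circle embedded in the sphere, whose regular neighbourhood is an
  annulus: it has two boundary components, although there are no half-edges.
\<close>

definition boundary_components :: "'b list \<Rightarrow> (nat \<Rightarrow> level) \<Rightarrow> nat" where
  "boundary_components C \<phi> =
     (if C = [] then 2
      else card (orbit (across_band C \<circ> disc_next C \<phi>) ` half_edges C))"

text \<open>
  The solution \<open>g\<close> of \<open>2 - 2g = f - n\<close>, in the reals in order to avoid truncating operations.
\<close>

definition genus :: "'b list \<Rightarrow> (nat \<Rightarrow> level) \<Rightarrow> real" where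
  "genus C \<phi> = (2 + real (card (set C)) - real (boundary_components C \<phi>)) / 2"

definition minimal_genus :: "'b list \<Rightarrow> real" where
  "minimal_genus C = Min {genus C \<phi> | \<phi>. framing C \<phi>}"

lemma finite_genera: "finite {genus C \<phi> | \<phi>. framing C \<phi>}"
proof -
  have fin: "finite (half_edges C)"
  proof -
    have "(UNIV :: sign set) = {Pos, Neg}" using sign.exhaust by blast
    then have "finite (UNIV :: sign set)" by (metis finite.emptyI finite.insertI)
    then show ?thesis by (simp add: half_edges_def finite_cartesian_product)
  qed
  have "boundary_components C \<phi> \<le> max 2 (card (half_edges C))" for \<phi>
    using card_image_le[OF fin, of "orbit (across_band C \<circ> disc_next C \<phi>)"]
    by (auto simp: boundary_components_def)
  then have "{genus C \<phi> | \<phi>. framing C \<phi>} \<subseteq>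
      (\<lambda>f. (2 + real (card (set C)) - real f) / 2) ` {..max 2 (card (half_edges C))}"
    by (auto simp: genus_def)
  then show ?thesis
    by (rule finite_subset) simp
qed

section \<open>Forms over the field with two elements\<close>

text \<open>
  The rank of a \<open>V \<times> V\<close> matrix is the dimension of the span of its rows, which are regarded as
  functions vanishing outside \<open>V\<close>.
\<close>

definition matrix_rank :: "'a set \<Rightarrow> ('a \<Rightarrow> 'a \<Rightarrow> bit) \<Rightarrow> nat" where
  "matrix_rank V M =
     vector_space.dim (\<lambda>(c :: bit) (f :: 'a \<Rightarrow> bit) y. c * f y)
       ((\<lambda>x y. if y \<in> V then M x y else 0) ` V)"

lemma vector_space_bit_fun: "vector_space (\<lambda>(c :: bit) (f :: 'a \<Rightarrow> bit) y. c * f y)"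
  by unfold_locales (auto simp: fun_eq_iff algebra_simps)

lemma matrix_rank_le_card:
  assumes "finite V"
  shows "matrix_rank V M \<le> card V"
  unfolding matrix_rank_def
  using vector_space.dim_le_card'[OF vector_space_bit_fun, OF finite_imageI[OF assms]]
    card_image_le[OF assms] by (rule order_trans)

definition adjacency :: "'a pair_pre_digraph \<Rightarrow> 'a \<Rightarrow> 'a \<Rightarrow> bit" where
  "adjacency G x y = (if (x, y) \<in> parcs G then 1 else 0)"

definition rosenstiehl_form :: "'a pair_pre_digraph \<Rightarrow> 'a \<Rightarrow> 'a \<Rightarrow> bit" where
  "rosenstiehl_form G x y =
     adjacency G x y + (\<Sum>z\<in>pverts G. adjacency G x z * adjacency G z y)"

datatype colour = Black | White

definition colour_form :: "'a pair_pre_digraph \<Rightarrow> ('a \<Rightarrow> colour) \<Rightarrow> 'a \<Rightarrow> 'a \<Rightarrow> bit" where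
  "colour_form G \<chi> x y = (if (x, y) \<in> parcs G \<and> \<chi> x \<noteq> \<chi> y then 1 else 0)"

definition neighbours :: "'a pair_pre_digraph \<Rightarrow> 'a \<Rightarrow> 'a set" where
  "neighbours G x = {y. (x, y) \<in> parcs G}"

section \<open>Cochains\<close>

text \<open>
  A 1-cochain modulo 2 is a function on the edges; it is represented by the symmetric matrix which
  takes its values on the edges and is 0 on all other pairs. All 1-cochains of a graph are cocycles.
\<close>

definition cocycles :: "'a pair_pre_digraph \<Rightarrow> ('a \<Rightarrow> 'a \<Rightarrow> bit) set" where
  "cocycles G = {c. (\<forall>x y. c x y = c y x) \<and> (\<forall>x y. (x, y) \<notin> parcs G \<longrightarrow> c x y = 0)}"

definition coboundary :: "'a pair_pre_digraph \<Rightarrow> ('a \<Rightarrow> bit) \<Rightarrow> 'a \<Rightarrow> 'a \<Rightarrow> bit" where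
  "coboundary G f x y = (if (x, y) \<in> parcs G then f y - f x else 0)"

definition coboundaries :: "'a pair_pre_digraph \<Rightarrow> ('a \<Rightarrow> 'a \<Rightarrow> bit) set" where
  "coboundaries G = range (coboundary G)"

definition rosenstiehl_cocycle :: "'a pair_pre_digraph \<Rightarrow> 'a \<Rightarrow> 'a \<Rightarrow> bit" where
  "rosenstiehl_cocycle G x y = (if (x, y) \<in> parcs G then rosenstiehl_form G x y else 0)"

lemma parcs_sym:
  assumes "pair_graph G"
  shows "(x, y) \<in> parcs G \<longleftrightarrow> (y, x) \<in> parcs G"
proof -
  interpret pair_graph G by fact
  show ?thesis using pair_sym_arcs by (auto simp: symmetric_def dest: symD)
qed

lemma rosenstiehl_cocycle_in_cocycles:
  assumes "pair_graph G"
  shows "rosenstiehl_cocycle G \<in> cocycles G"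
proof -
  have adj: "adjacency G x y = adjacency G y x" for x y
    using parcs_sym[OF assms, of x y] by (simp add: adjacency_def)
  have "adjacency G x z * adjacency G z y = adjacency G y z * adjacency G z x" for x y z
    using adj[of x z] adj[of z y] by (simp add: mult.commute)
  then have "rosenstiehl_form G x y = rosenstiehl_form G y x" for x y
    unfolding rosenstiehl_form_def by (metis (no_types, lifting) adj sum.cong)
  then show ?thesis
    using parcs_sym[OF assms] by (auto simp: cocycles_def rosenstiehl_cocycle_def)
qed

lemma coboundaries_subset_cocycles:
  assumes "pair_graph G"
  shows "coboundaries G \<subseteq> cocycles G"
  using parcs_sym[OF assms]
  by (auto simp: coboundaries_def cocycles_def coboundary_def add.commute)

end

theory Submission
  imports Defs
begin

text \<open>
  The number of regions of the filoop is the dimension of the space of functions on the set of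
  regions with values in the field of two elements. Such a function is determined by its value at
  one region and by its differences across the edges, which form a cycle of the immersed curve.
  A cycle is given by its value on one edge and by an arbitrary choice, at each double point \<open>x\<close>,
  of its change \<open>a x\<close> along the strands through \<open>x\<close>. It arises from a function on the regions
  if and only if its intersection number with each lobe of the loop vanishes. If the degrees are
  even and the chord \<open>x\<close> is coloured by the parity of the position of \<open>x\<^sub>\<infinity>\<close>, these conditions say
  that \<open>a\<close> lies in the kernel of \<open>\<rr> + \<cc>\<^sub>\<chi>\<close>. Hence \<open>f = 2 + n - rank (\<rr> + \<cc>\<^sub>\<chi>)\<close>, and
  every colouring comes from exactly one framing.
\<close>

section \<open>Linear algebra over the field with two elements\<close>

text \<open>
  By default the simplifier turns sums and products of bits into bit operations, on which no
  ring reasoning is available.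
\<close>

declare add_bit_eq_xor [simp del] mult_bit_eq_and [simp del]

lemma bit_add_self [simp]: "x + x = (0 :: bit)"
  by (cases x) (simp_all flip: mult_2)

lemma bit_add_self_left [simp]: "x + (x + y) = (y :: bit)"
  by (simp flip: add.assoc)

lemma card_UNIV_bit: "card (UNIV :: bit set) = 2"
proof -
  have U: "(UNIV :: bit set) = {0, 1}" using bit_not_one_iff by blast
  show ?thesis by (simp add: U)
qed

section \<open>Counting bit-valued functions and permutation orbits\<close>

definition bit_funs :: "'a set \<Rightarrow> ('a \<Rightarrow> bit) set" where
  "bit_funs V = {a. \<forall>x. x \<notin> V \<longrightarrow> a x = 0}"

lemma bij_betw_Pow_bit_funs: "bij_betw (\<lambda>P x. of_bool (x \<in> P)) (Pow V) (bit_funs V)"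
  by (rule bij_betw_byWitness[where f' = "\<lambda>a. {x. a x = 1}"])
    (auto simp: bit_funs_def fun_eq_iff of_bool_def)

lemma card_bit_funs: "card (bit_funs V) = 2 ^ card V" if "finite V"
  using bij_betw_same_card[OF bij_betw_Pow_bit_funs[of V]] that by (simp add: card_Pow)

lemma finite_bit_funs: "finite (bit_funs V)" if "finite V"
  using bij_betw_finite[OF bij_betw_Pow_bit_funs[of V]] that by simp

text \<open>An invariant function is constant on orbits, so it amounts to the set of orbits on which
  it is \<open>1\<close>. This turns the number of boundary components into the exponent of a
  cardinality.\<close>

lemma card_invariant_bit_funs:
  assumes fin: "finite H" and inj: "inj_on \<sigma> H" and sub: "\<sigma> ` H \<subseteq> H"
  shows "card {h \<in> bit_funs H. \<forall>x\<in>H. h (\<sigma> x) = h x} = 2 ^ card (orbit \<sigma> ` H)"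
proof -
  \<comment> \<open>Extended by the identity, \<open>\<sigma>\<close> becomes a permutation of the
    whole type. This is how each point is known to lie in its own orbit, which by definition starts
    only at \<open>\<sigma> x\<close>.\<close>
  define \<tau> where "\<tau> x = (if x \<in> H then \<sigma> x else x)" for x
  have "\<sigma> ` H = H" using fin inj sub by (simp add: endo_inj_surj)
  then have "bij_betw \<tau> H H"
    using inj by (auto simp: \<tau>_def bij_betw_def inj_on_def)
  then have perm: "\<tau> permutes H" by (rule bij_imp_permutes) (simp add: \<tau>_def)
  then have "permutation \<tau>" using fin permutation_permutes by blast
  moreover have orb: "orbit \<sigma> x = orbit \<tau> x" if "x \<in> H" for x
    using that sub by (intro orbit_cong0[where A = H]) (auto simp: \<tau>_def)
  ultimately have self: "x \<in> orbit \<sigma> x" if "x \<in> H" for x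
    using that by (simp add: permutation_self_in_orbit)
  have orbit_H: "orbit \<sigma> x \<subseteq> H" if "x \<in> H" for x
    using that orb permutes_orbit_subset[OF perm] by simp
  have inv: "h y = h x" if "\<forall>x\<in>H. h (\<sigma> x) = (h x :: bit)" "x \<in> H" "y \<in> orbit \<sigma> x" for h x y
    using that(3)
  proof induction
    case base
    then show ?case using that by simp
  next
    case (step y)
    then have "y \<in> H" using orbit_H[OF that(2)] by blast
    then show ?case using step that(1) by simp
  qed
  let ?f = "\<lambda>P x. if x \<in> H then of_bool (orbit \<sigma> x \<in> P) else (0 :: bit)"
  let ?g = "\<lambda>h. {orbit \<sigma> x | x. x \<in> H \<and> h x = (1 :: bit)}"
  have "bij_betw ?f (Pow (orbit \<sigma> ` H)) {h \<in> bit_funs H. \<forall>x\<in>H. h (\<sigma> x) = h x}"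
  proof (rule bij_betw_byWitness[where f' = ?g])
    show "\<forall>P\<in>Pow (orbit \<sigma> ` H). ?g (?f P) = P"
      by (auto split: if_splits)
    show "\<forall>h\<in>{h \<in> bit_funs H. \<forall>x\<in>H. h (\<sigma> x) = h x}. ?f (?g h) = h"
    proof
      fix h assume h: "h \<in> {h \<in> bit_funs H. \<forall>x\<in>H. h (\<sigma> x) = h x}"
      have "orbit \<sigma> x \<in> ?g h \<longleftrightarrow> h x = 1" if "x \<in> H" for x
      proof
        assume "orbit \<sigma> x \<in> ?g h"
        then obtain y where "y \<in> H" "h y = 1" "orbit \<sigma> x = orbit \<sigma> y" by auto
        then show "h x = 1" using inv[of h y x] h self[OF that] by auto
      qed (use that in auto)
      then show "?f (?g h) = h"
        using h by (auto simp: fun_eq_iff bit_funs_def simp del: mem_Collect_eq)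
    qed
    show "?f ` Pow (orbit \<sigma> ` H) \<subseteq> {h \<in> bit_funs H. \<forall>x\<in>H. h (\<sigma> x) = h x}"
      using sub self by (auto simp: bit_funs_def self_in_orbit_step image_subset_iff)
    show "?g ` {h \<in> bit_funs H. \<forall>x\<in>H. h (\<sigma> x) = h x} \<subseteq> Pow (orbit \<sigma> ` H)"
      by auto
  qed
  from bij_betw_same_card[OF this] show ?thesis
    using fin by (simp add: card_Pow)
qed

section \<open>Rank and nullity by counting vectors\<close>

lemma card_eq_card_kernel_mult_card_image:
  fixes T :: "('a \<Rightarrow> bit) \<Rightarrow> ('b \<Rightarrow> bit)"
  assumes fin: "finite W" and closed: "\<And>a b. a \<in> W \<Longrightarrow> b \<in> W \<Longrightarrow> a + b \<in> W"
    and add: "\<And>a b. a \<in> W \<Longrightarrow> b \<in> W \<Longrightarrow> T (a + b) = T a + T b"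
  shows "card W = card {a \<in> W. T a = 0} * card (T ` W)"
proof -
  have self: "a + a = 0" for a :: "'c \<Rightarrow> bit" by (simp add: fun_eq_iff)
  have self_left: "a + (a + b) = b" for a b :: "'c \<Rightarrow> bit" by (simp add: fun_eq_iff)
  \<comment> \<open>In characteristic two, translation by \<open>b\<close> is its own inverse; it
    exchanges the fibre over \<open>T b\<close> with the kernel.\<close>
  have fibre: "card {a \<in> W. T a = T b} = card {a \<in> W. T a = 0}" if "b \<in> W" for b
  proof (rule bij_betw_same_card, rule bij_betw_byWitness[where f = "(+) b" and f' = "(+) b"])
    show "(+) b ` {a \<in> W. T a = T b} \<subseteq> {a \<in> W. T a = 0}"
      using that by (auto simp: closed add self fun_eq_iff)
    show "(+) b ` {a \<in> W. T a = 0} \<subseteq> {a \<in> W. T a = T b}"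
      using that by (auto simp: closed add)
  qed (auto simp: self_left fun_eq_iff)
  have "card W = card (\<Union>y\<in>T ` W. {a \<in> W. T a = y})"
    by (rule arg_cong[where f = card]) auto
  also have "\<dots> = (\<Sum>y\<in>T ` W. card {a \<in> W. T a = y})"
    using fin by (intro card_UN_disjoint) auto
  also have "\<dots> = (\<Sum>y\<in>T ` W. card {a \<in> W. T a = 0})"
    using fibre by (intro sum.cong) auto
  finally show ?thesis by simp
qed

text \<open>The only coefficients are 0 and 1, so adjoining an independent vector \<open>b\<close>
  adds to the span exactly its translate by \<open>b\<close>. The two are disjoint and the size
  doubles.\<close>

lemma card_span_bit:
  fixes B :: "('a \<Rightarrow> bit) set"
  assumes "finite B" and "\<not> module.dependent (\<lambda>(c :: bit) (f :: 'a \<Rightarrow> bit) y. c * f y) B"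
  shows "finite (module.span (\<lambda>(c :: bit) (f :: 'a \<Rightarrow> bit) y. c * f y) B) \<and>
    card (module.span (\<lambda>(c :: bit) (f :: 'a \<Rightarrow> bit) y. c * f y) B) = 2 ^ card B"
proof -
  interpret vs: vector_space "\<lambda>(c :: bit) (f :: 'a \<Rightarrow> bit) y. c * f y"
    by (rule vector_space_bit_fun)
  have self_left: "a + (a + b) = b" for a b :: "'a \<Rightarrow> bit" by (simp add: fun_eq_iff)
  show ?thesis using assms
  proof (induction B rule: finite_induct)
    case empty
    then show ?case by simp
  next
    case (insert b B)
    then have indep: "vs.independent B" "b \<notin> vs.span B" by (auto simp: vs.independent_insert)
    have "vs.span (insert b B) = vs.span B \<union> (+) b ` vs.span B"
    proof (intro set_eqI)
      fix x
      have "(\<exists>k. P k) \<longleftrightarrow> P 0 \<or> P (1 :: bit)" for P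
      proof -
        have "P k \<Longrightarrow> P 0 \<or> P 1" for k by (cases k) auto
        then show ?thesis by blast
      qed
      then have "x \<in> vs.span (insert b B) \<longleftrightarrow> x \<in> vs.span B \<or> b + x \<in> vs.span B"
        by (simp add: vs.span_breakdown_eq fun_diff_def plus_fun_def add.commute)
      also have "b + x \<in> vs.span B \<longleftrightarrow> x \<in> (+) b ` vs.span B"
        by (auto simp: image_iff self_left intro!: bexI[of _ "b + x"])
      finally show "x \<in> vs.span (insert b B) \<longleftrightarrow> x \<in> vs.span B \<union> (+) b ` vs.span B" by simp
    qed
    moreover have "vs.span B \<inter> (+) b ` vs.span B = {}"
    proof -
      have "b + y \<notin> vs.span B" if "y \<in> vs.span B" for y
        using indep(2) vs.span_add_eq2[OF that, of b] by simp
      then show ?thesis by auto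
    qed
    moreover have "card ((+) b ` vs.span B) = card (vs.span B)"
      by (intro card_image inj_onI) simp
    ultimately show ?case
      using insert indep by (simp add: card_Un_disjoint)
  qed
qed

lemma sum_fun_apply: "(\<Sum>x\<in>A. f x) y = (\<Sum>x\<in>A. f x y)" for f :: "'a \<Rightarrow> 'b \<Rightarrow> bit"
  by (induction A rule: infinite_finite_induct) simp_all

definition bit_kernel :: "'a set \<Rightarrow> ('a \<Rightarrow> 'a \<Rightarrow> bit) \<Rightarrow> ('a \<Rightarrow> bit) set" where
  "bit_kernel V M = {a \<in> bit_funs V. \<forall>x\<in>V. (\<Sum>y\<in>V. M x y * a y) = 0}"

text \<open>The map \<open>T\<close> combines the rows of \<open>M\<close> with given coefficients,
  so its image is the row space, of size 2 to the power of the rank. By symmetry its kernel is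
  \<open>bit_kernel V M\<close>, and counting fibres gives the formula.\<close>

lemma rank_nullity_bit:
  assumes fin: "finite V" and sym: "\<And>x y. x \<in> V \<Longrightarrow> y \<in> V \<Longrightarrow> M x y = M y x"
  shows "card (bit_kernel V M) * 2 ^ matrix_rank V M = 2 ^ card V"
proof -
  interpret vs: vector_space "\<lambda>(c :: bit) (f :: 'a \<Rightarrow> bit) y. c * f y"
    by (rule vector_space_bit_fun)
  define T where "T a = (\<lambda>y. if y \<in> V then \<Sum>x\<in>V. M x y * a x else 0)" for a
  define R where "R = (\<lambda>x y. if y \<in> V then M x y else 0) ` V"
  have T_add: "T (a + b) = T a + T b" for a b
    by (auto simp: T_def fun_eq_iff algebra_simps sum.distrib)
  have sub: "vs.subspace (T ` bit_funs V)"
  proof (intro vs.subspaceI)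
    show "0 \<in> T ` bit_funs V"
      by (rule image_eqI[of _ _ 0]) (auto simp: T_def bit_funs_def fun_eq_iff)
  next
    fix f g assume "f \<in> T ` bit_funs V" "g \<in> T ` bit_funs V"
    then obtain a b where "f = T a" "g = T b" "a \<in> bit_funs V" "b \<in> bit_funs V" by auto
    then show "f + g \<in> T ` bit_funs V"
      by (intro image_eqI[of _ _ "a + b"]) (auto simp: T_add bit_funs_def)
  next
    fix c f assume "f \<in> T ` bit_funs V"
    then obtain a where "f = T a" "a \<in> bit_funs V" by auto
    then show "(\<lambda>y. c * f y) \<in> T ` bit_funs V"
      by (intro image_eqI[of _ _ "\<lambda>y. c * a y"])
        (auto simp: T_def bit_funs_def fun_eq_iff sum_distrib_left mult.left_commute)
  qed
  have "R \<subseteq> T ` bit_funs V"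
  proof
    fix f assume "f \<in> R"
    then obtain x where x: "x \<in> V" "f = (\<lambda>y. if y \<in> V then M x y else 0)" by (auto simp: R_def)
    then have "f = T (\<lambda>z. of_bool (z = x))"
      using fin by (auto simp: T_def fun_eq_iff of_bool_def if_distrib cong: if_cong)
    then show "f \<in> T ` bit_funs V" using x by (auto simp: bit_funs_def)
  qed
  moreover have "T a \<in> vs.span R" for a
  proof -
    have "T a = (\<Sum>x\<in>V. (\<lambda>y. a x * (if y \<in> V then M x y else 0)))"
      using fin by (auto simp: T_def fun_eq_iff sum_fun_apply mult.commute)
    also have "\<dots> \<in> vs.span R"
      by (intro vs.span_sum vs.span_scale vs.span_base) (auto simp: R_def)
    finally show ?thesis .
  qed
  ultimately have span_R: "vs.span R = T ` bit_funs V"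
    using sub vs.span_minimal by blast
  obtain B where B: "B \<subseteq> R" "vs.independent B" "R \<subseteq> vs.span B" "card B = vs.dim R"
    by (rule vs.basis_exists)
  have "finite B" using B(1) fin finite_subset by (auto simp: R_def)
  moreover have "vs.span B = vs.span R"
    using B by (simp add: vs.span_mono vs.span_minimal subset_antisym)
  ultimately have "card (vs.span R) = 2 ^ matrix_rank V M"
    using card_span_bit[of B] B by (simp add: matrix_rank_def R_def)
  moreover have "{a \<in> bit_funs V. T a = 0} = bit_kernel V M"
    using sym by (auto simp: bit_kernel_def T_def fun_eq_iff intro!: sum.cong cong: sum.cong)
  moreover have "card (bit_funs V) = card {a \<in> bit_funs V. T a = 0} * card (T ` bit_funs V)"
    using fin by (intro card_eq_card_kernel_mult_card_image finite_bit_funs T_add)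
      (auto simp: bit_funs_def)
  ultimately show ?thesis using fin span_R by (simp add: card_bit_funs)
qed

section \<open>Positions of the chords\<close>

lemma other_occurrence:
  assumes C: "chord_diagram C" and i: "i < length C"
  shows other_occurrence_less: "other_occurrence C i < length C"
    and other_occurrence_neq: "other_occurrence C i \<noteq> i"
    and nth_other_occurrence: "C ! other_occurrence C i = C ! i"
    and occurrence_cases: "j < length C \<Longrightarrow> C ! j = C ! i \<Longrightarrow> j = i \<or> j = other_occurrence C i"
    and other_occurrence_other: "other_occurrence C (other_occurrence C i) = i"
proof -
  have "card {j. j < length C \<and> C ! i = C ! j} = 2"
    using C i by (simp add: chord_diagram_def count_list_eq_length_filter length_filter_conv_card)
  then obtain u v where uv: "{j. j < length C \<and> C ! i = C ! j} = {u, v}" "u \<noteq> v"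
    by (auto simp: card_2_iff)
  then have "j < length C \<and> C ! i = C ! j \<longleftrightarrow> j = u \<or> j = v" for j
    by (metis (mono_tags, lifting) mem_Collect_eq insert_iff singletonD)
  then have occ: "j < length C \<and> C ! j = C ! i \<longleftrightarrow> j = u \<or> j = v" for j
    by metis
  define w where "w = (if i = u then v else u)"
  have w: "i \<noteq> w" and occ': "j < length C \<and> C ! j = C ! i \<longleftrightarrow> j = i \<or> j = w" for j
    unfolding occ using occ[of i] i uv(2) by (auto simp: w_def)
  then have wC: "w < length C" "C ! w = C ! i" by blast+
  have oi: "other_occurrence C i = w"
    unfolding other_occurrence_def using w wC occ' by (intro the_equality) blast+
  have ow: "other_occurrence C w = i"
    unfolding other_occurrence_def wC using w i occ' by (intro the_equality) blast+
  show "other_occurrence C i < length C" "other_occurrence C i \<noteq> i"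
    "C ! other_occurrence C i = C ! i"
    "other_occurrence C (other_occurrence C i) = i"
    using oi ow w wC by simp_all
  show "j < length C \<Longrightarrow> C ! j = C ! i \<Longrightarrow> j = i \<or> j = other_occurrence C i"
    unfolding oi using occ' by blast
qed

lemma ex_occurrences:
  assumes C: "chord_diagram C" and x: "x \<in> set C"
  obtains p q where "p < q" "q < length C" "C ! p = x" "C ! q = x"
    "other_occurrence C p = q" "other_occurrence C q = p"
proof -
  obtain i where i: "i < length C" "C ! i = x" using x by (auto simp: in_set_conv_nth)
  note o = other_occurrence[OF C i(1)]
  show thesis
  proof (cases "i < other_occurrence C i")
    case True
    then show ?thesis using that[of i "other_occurrence C i"] o i by simp
  next
    case False
    then show ?thesis using that[of "other_occurrence C i" i] o i by simp
  qed
qed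

text \<open>Each letter has only two occurrences, so the four alternating positions must be
  \<open>p\<close>, \<open>q\<close>, \<open>u\<close>, \<open>v\<close>.\<close>

lemma interlaced_iff_positions:
  assumes C: "chord_diagram C" and "x \<noteq> y"
    and p: "p < q" "q < length C" "C ! p = x" "C ! q = x"
    and u: "u < v" "v < length C" "C ! u = y" "C ! v = y"
  shows "interlaced C x y \<longleftrightarrow> p < u \<and> u < q \<and> q < v \<or> u < p \<and> p < v \<and> v < q"
proof -
  have px: "k = p \<or> k = q" if "k < length C" "C ! k = x" for k
    using occurrence_cases[OF C, of p k] occurrence_cases[OF C, of p q] that p by auto
  have uy: "k = u \<or> k = v" if "k < length C" "C ! k = y" for k
    using occurrence_cases[OF C, of u k] occurrence_cases[OF C, of u v] that u by auto
  show ?thesis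
  proof
    assume "interlaced C x y"
    then obtain i j k l where ijkl: "i < j" "j < k" "k < l" "l < length C"
      "C ! i = x \<and> C ! j = y \<and> C ! k = x \<and> C ! l = y \<or>
       C ! i = y \<and> C ! j = x \<and> C ! k = y \<and> C ! l = x"
      by (auto simp: interlaced_def)
    from ijkl(5) show "p < u \<and> u < q \<and> q < v \<or> u < p \<and> p < v \<and> v < q"
    proof
      assume "C ! i = x \<and> C ! j = y \<and> C ! k = x \<and> C ! l = y"
      then have "i = p" "k = q" "j = u" "l = v"
        using px[of i] px[of k] uy[of j] uy[of l] ijkl(1-4) p(1) u(1) by auto
      then show ?thesis using ijkl by auto
    next
      assume "C ! i = y \<and> C ! j = x \<and> C ! k = y \<and> C ! l = x"
      then have "j = p" "l = q" "i = u" "k = v"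
        using px[of j] px[of l] uy[of i] uy[of k] ijkl(1-4) p(1) u(1) by auto
      then show ?thesis using ijkl by auto
    qed
  next
    assume "p < u \<and> u < q \<and> q < v \<or> u < p \<and> p < v \<and> v < q"
    then show "interlaced C x y"
      unfolding interlaced_def using assms by blast
  qed
qed

lemma adjacency_interlace_graph:
  "adjacency (interlace_graph C) x y = of_bool (interlaced C x y)"
  by (simp add: adjacency_def interlace_graph_def)

section \<open>Sums over positions regrouped by chords\<close>

lemma sum_positions:
  fixes g :: "'b \<Rightarrow> bit"
  assumes "A \<subseteq> {..<length C}"
  shows "(\<Sum>m\<in>A. g (C ! m)) = (\<Sum>y\<in>set C. of_nat (card {m \<in> A. C ! m = y}) * g y)"
proof -
  have "finite A" using assms finite_subset by blast
  then have "(\<Sum>m\<in>A. g (C ! m)) = (\<Sum>y\<in>set C. \<Sum>m\<in>{m \<in> A. C ! m = y}. g (C ! m))"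
    using assms by (intro sum.group[symmetric]) auto
  also have "\<dots> = (\<Sum>y\<in>set C. of_nat (card {m \<in> A. C ! m = y}) * g y)"
    by (intro sum.cong) auto
  finally show ?thesis .
qed

lemma sum_all_positions:
  fixes g :: "'b \<Rightarrow> bit"
  assumes C: "chord_diagram C"
  shows "(\<Sum>m<length C. g (C ! m)) = 0"
proof -
  have "{m \<in> {..<length C}. C ! m = y} = {m. m < length C \<and> y = C ! m}" for y by auto
  then have "card {m \<in> {..<length C}. C ! m = y} = 2" if "y \<in> set C" for y
    using C that
    by (simp add: chord_diagram_def count_list_eq_length_filter length_filter_conv_card)
  then show ?thesis by (subst sum_positions) auto
qed

text \<open>A chord interlaced with \<open>C ! p\<close> has exactly one occurrence strictly between
  \<open>p\<close> and \<open>q\<close>; any other chord has none or two, which cancel modulo 2.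
  This is how the adjacency matrix enters.\<close>

lemma sum_between_occurrences:
  fixes g :: "'b \<Rightarrow> bit"
  assumes C: "chord_diagram C" and p: "p < q" "q < length C" "C ! p = C ! q"
  shows "(\<Sum>m\<in>{p<..<q}. g (C ! m)) =
    (\<Sum>y\<in>set C. adjacency (interlace_graph C) (C ! p) y * g y)"
proof -
  have "of_nat (card {m \<in> {p<..<q}. C ! m = y}) = (of_bool (interlaced C (C ! p) y) :: bit)"
    if y: "y \<in> set C" for y
  proof (cases "y = C ! p")
    case True
    have "m = p \<or> m = q" if "m < length C" "C ! m = y" for m
      using occurrence_cases[OF C, of p m] occurrence_cases[OF C, of p q] that p True by auto
    with p have empty: "{m \<in> {p<..<q}. C ! m = y} = {}" by (auto dest: less_trans)
    show ?thesis unfolding empty using True by (simp add: interlaced_def)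
  next
    case False
    obtain u v where u: "u < v" "v < length C" "C ! u = y" "C ! v = y"
      "other_occurrence C u = v"
      by (rule ex_occurrences[OF C y])
    have occ: "m = u \<or> m = v" if "m < q" "C ! m = y" for m
      using occurrence_cases[OF C, of u m] that u p by auto
    have set: "{m \<in> {p<..<q}. C ! m = y} = {u, v} \<inter> {p<..<q}"
    proof (intro set_eqI)
      show "m \<in> {m \<in> {p<..<q}. C ! m = y} \<longleftrightarrow> m \<in> {u, v} \<inter> {p<..<q}" for m
        using occ[of m] u(3,4) by auto
    qed
    have neq: "p \<noteq> u" "p \<noteq> v" "q \<noteq> u" "q \<noteq> v" 
      using False u(3,4) p(3) by metis+
    have "interlaced C (C ! p) y \<longleftrightarrow> p < u \<and> u < q \<and> q < v \<or> u < p \<and> p < v \<and> v < q"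
      by (rule interlaced_iff_positions[OF C _ p(1,2) refl p(3)[symmetric] u(1-4)])
        (use False in simp)
    moreover have "(u \<in> {p<..<q}) = (p < u \<and> u < q)" "(v \<in> {p<..<q}) = (p < v \<and> v < q)"
      by auto
    ultimately show ?thesis
      unfolding set using neq u(1) p(1)
      by (cases "u \<in> {p<..<q}"; cases "v \<in> {p<..<q}") (auto simp: Int_insert_left)
  qed
  moreover have "{p<..<q} \<subseteq> {..<length C}" using p by auto
  ultimately show ?thesis
    by (subst sum_positions) (simp_all add: adjacency_interlace_graph)
qed

section \<open>Parities of positions\<close>

definition even_degrees :: "'a pair_pre_digraph \<Rightarrow> bool" where
  "even_degrees G \<longleftrightarrow> (\<forall>x\<in>pverts G. even (card (neighbours G x)))"

lemma sum_adjacency_eq_degree: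
  "(\<Sum>y\<in>set C. adjacency (interlace_graph C) x y) =
    of_nat (card (neighbours (interlace_graph C) x))"
proof -
  have "set C \<inter> {y. interlaced C x y} = neighbours (interlace_graph C) x"
    by (auto simp: neighbours_def interlace_graph_def interlaced_def)
  then show ?thesis by (simp add: adjacency_interlace_graph)
qed

text \<open>Summing the constant 1 between the occurrences shows that their gap
  \<open>q - Suc p\<close> has the parity of the degree of the chord.\<close>

lemma occurrences_opposite_parity:
  assumes C: "chord_diagram C" and even: "even_degrees (interlace_graph C)"
    and p: "p < q" "q < length C" "C ! p = C ! q"
  shows "of_nat p = (of_nat (Suc q) :: bit)"
proof -
  have "C ! p \<in> pverts (interlace_graph C)" using p by (simp add: interlace_graph_def)
  then have "even (card (neighbours (interlace_graph C) (C ! p)))"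
    using even by (simp add: even_degrees_def)
  then have "(\<Sum>m\<in>{p<..<q}. 1 :: bit) = 0"
    using sum_between_occurrences[OF C p, of "\<lambda>_. 1"] sum_adjacency_eq_degree[of C "C ! p"]
    by (auto elim!: evenE)
  then have "of_nat (q - Suc p) = (0 :: bit)" by simp
  moreover have "of_nat (Suc q) = (of_nat p + of_nat (q - Suc p) :: bit)"
    using p(1) by (simp flip: of_nat_add add: of_nat_Suc)
  ultimately show ?thesis by simp
qed

lemma even_length_chord_diagram: "chord_diagram C \<Longrightarrow> of_nat (length C) = (0 :: bit)"
  using sum_all_positions[of C "\<lambda>_. 1"] by simp

section \<open>Dual potentials of the regions\<close>

text \<open>
  Edge \<open>k\<close> of the loop runs from occurrence \<open>k - 1\<close> to occurrence \<open>k\<close>, cyclically. Label the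
  regions with bits. Then \<open>edge_chain\<close> is the difference of the labels on the two sides of an edge,
  a cycle of the immersed curve which changes by \<open>a x\<close> at both passages through the double point
  \<open>x\<close>, and \<open>left_side\<close> is the label on the left of an edge. On passing an occurrence, the loop
  crosses over to the other side of the strand through the other occurrence, whence \<open>jump\<close>.
\<close>

definition edge_chain :: "'b list \<Rightarrow> ('b \<Rightarrow> bit) \<Rightarrow> bit \<Rightarrow> nat \<Rightarrow> bit" where
  "edge_chain C a t k = t + (\<Sum>m<k. a (C ! m))"

definition jump :: "'b list \<Rightarrow> (nat \<Rightarrow> level) \<Rightarrow> ('b \<Rightarrow> bit) \<Rightarrow> bit \<Rightarrow> nat \<Rightarrow> bit" where
  "jump C \<phi> a t m = edge_chain C a t
     (case \<phi> m of Infty \<Rightarrow> Suc (other_occurrence C m) | Zero \<Rightarrow> other_occurrence C m)"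

definition left_side :: "'b list \<Rightarrow> (nat \<Rightarrow> level) \<Rightarrow> ('b \<Rightarrow> bit) \<Rightarrow> bit \<Rightarrow> bit \<Rightarrow> nat \<Rightarrow> bit" where
  "left_side C \<phi> a t l k = l + (\<Sum>m<k. jump C \<phi> a t m)"

definition adj_apply :: "'b list \<Rightarrow> ('b \<Rightarrow> bit) \<Rightarrow> 'b \<Rightarrow> bit" where
  "adj_apply C a x = (\<Sum>y\<in>set C. adjacency (interlace_graph C) x y * a y)"

section \<open>Summation along an interval of the loop\<close>

lemma edge_chain_Suc: "edge_chain C a t (Suc k) = edge_chain C a t k + a (C ! k)"
  by (simp add: edge_chain_def ac_simps)

lemma left_side_Suc: "left_side C \<phi> a t l (Suc k) = left_side C \<phi> a t l k + jump C \<phi> a t k"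
  by (simp add: left_side_def ac_simps)

lemma edge_chain_add:
  "k \<le> n \<Longrightarrow> edge_chain C a t n = edge_chain C a t k + (\<Sum>m\<in>{k..<n}. a (C ! m))"
  by (simp add: edge_chain_def lessThan_atLeast0 add.assoc sum.atLeastLessThan_concat)

lemma left_side_add:
  "k \<le> n \<Longrightarrow> left_side C \<phi> a t l n = left_side C \<phi> a t l k + (\<Sum>m\<in>{k..<n}. jump C \<phi> a t m)"
  by (simp add: left_side_def lessThan_atLeast0 add.assoc sum.atLeastLessThan_concat)

text \<open>This is summation by parts. As \<open>k\<close> and \<open>n\<close> have the same
  parity, the two boundary terms combine to \<open>of_nat k\<close> times the total change of the
  chain, which is again a sum of values of \<open>a\<close>.\<close>

lemma sum_edge_chain:
  assumes "k \<le> n" and "of_nat k = (of_nat n :: bit)"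
  shows "(\<Sum>m\<in>{k..<n}. edge_chain C a t m) =
    (\<Sum>m\<in>{k..<n}. (of_nat k + of_nat (Suc m)) * a (C ! m))"
proof -
  have "(\<Sum>m\<in>{k..<n}. edge_chain C a t m) = of_nat n * edge_chain C a t n +
    of_nat k * edge_chain C a t k + (\<Sum>m\<in>{k..<n}. of_nat (Suc m) * a (C ! m))"
    using assms(1)
  proof (induction n rule: dec_induct)
    case base
    then show ?case by simp
  next
    case (step n)
    then show ?case
      by (cases "of_nat n :: bit"; cases "a (C ! n)"; cases "edge_chain C a t n")
        (simp_all add: edge_chain_Suc ac_simps)
  qed
  then show ?thesis
    using assms(2) edge_chain_add[OF assms(1), of C a t]
    by (simp add: algebra_simps sum.distrib sum_distrib_left)
qed

text \<open>Between its two occurrences a chord contributes \<open>a\<close> once, at the earlier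
  one, and the chords in between contribute their adjacency sum. Modulo 2 the formula is symmetric
  in the two occurrences, so their order is irrelevant.\<close>

lemma edge_chain_other_occurrence:
  assumes C: "chord_diagram C" and m: "m < length C"
  shows "edge_chain C a t (other_occurrence C m) =
    edge_chain C a t m + a (C ! m) + adj_apply C a (C ! m)"
proof -
  note o = other_occurrence[OF C m]
  have *: "edge_chain C a t q = edge_chain C a t p + a (C ! p) + adj_apply C a (C ! p)"
    if "p < q" "q < length C" "C ! p = C ! q" for p q
  proof -
    have "{p..<q} = insert p {p<..<q}" using that by auto
    then show ?thesis
      using edge_chain_add[of p q C a t] that
      by (simp add: sum_between_occurrences[OF C] adj_apply_def add.assoc)
  qed
  show ?thesis
  proof (cases "m < other_occurrence C m")
    case True
    then show ?thesis using *[OF True] o by simp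
  next
    case False
    then have "other_occurrence C m < m" using o by simp
    from *[OF this] show ?thesis using o m by (simp add: ac_simps)
  qed
qed

text \<open>Expresses the jump through the chain at the same position. The step past the other
  occurrence at level \<open>Infty\<close> cancels the summand \<open>a (C ! m)\<close>, which
  therefore survives only at level \<open>Zero\<close>.\<close>

lemma jump_eq:
  assumes "chord_diagram C" and "m < length C"
  shows "jump C \<phi> a t m =
    edge_chain C a t m + adj_apply C a (C ! m) + of_bool (\<phi> m = Zero) * a (C ! m)"
  using assms
  by (cases "\<phi> m")
    (simp_all add: jump_def edge_chain_Suc edge_chain_other_occurrence nth_other_occurrence ac_simps)

text \<open>
  Occurrences of one chord have opposite parities if the degrees are even. The colour of a chord
  is the parity of its occurrence at level \<open>\<infinity>\<close>.
\<close>

definition parity_framing :: "'b list \<Rightarrow> (nat \<Rightarrow> level) \<Rightarrow> ('b \<Rightarrow> bit) \<Rightarrow> bool" where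
  "parity_framing C \<phi> b \<longleftrightarrow> framing C \<phi> \<and>
    (\<forall>m<length C. of_nat m + of_bool (\<phi> m = Zero) = b (C ! m))"

text \<open>The weight \<open>of_nat (Suc m)\<close> from summation by parts and the level at
  \<open>m\<close> add up to \<open>1 + b (C ! m)\<close>. The summand then depends on the position
  only through its chord, so that sums over intervals can be evaluated chord by chord.\<close>

lemma sum_jump:
  assumes C: "chord_diagram C" and b: "parity_framing C \<phi> b"
    and k: "k \<le> n" "n \<le> length C" "of_nat k = (of_nat n :: bit)"
  shows "(\<Sum>m\<in>{k..<n}. jump C \<phi> a t m) =
    (\<Sum>m\<in>{k..<n}. adj_apply C a (C ! m) + (of_nat k + 1 + b (C ! m)) * a (C ! m))"
proof -
  have "(\<Sum>m\<in>{k..<n}. jump C \<phi> a t m) = (\<Sum>m\<in>{k..<n}. edge_chain C a t m) +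
    (\<Sum>m\<in>{k..<n}. adj_apply C a (C ! m) + of_bool (\<phi> m = Zero) * a (C ! m))"
    unfolding sum.distrib[symmetric] using k
    by (intro sum.cong) (auto simp: jump_eq[OF C])
  also have "\<dots> =
    (\<Sum>m\<in>{k..<n}. adj_apply C a (C ! m) + (of_nat k + 1 + b (C ! m)) * a (C ! m))"
    unfolding sum_edge_chain[OF k(1,3)] sum.distrib[symmetric]
  proof (intro sum.cong refl)
    fix m assume "m \<in> {k..<n}"
    then have "b (C ! m) = of_nat m + of_bool (\<phi> m = Zero)"
      using b k by (simp add: parity_framing_def)
    then show "(of_nat k + of_nat (Suc m)) * a (C ! m) +
        (adj_apply C a (C ! m) + of_bool (\<phi> m = Zero) * a (C ! m)) =
        adj_apply C a (C ! m) + (of_nat k + 1 + b (C ! m)) * a (C ! m)"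
      by (simp add: algebra_simps)
  qed
  finally show ?thesis .
qed

lemma edge_chain_length: "chord_diagram C \<Longrightarrow> edge_chain C a t (length C) = t"
  by (simp add: edge_chain_def sum_all_positions)

text \<open>In one full turn every chord is met twice, so the jumps cancel and the left labels are
  periodic.\<close>

lemma left_side_length:
  assumes C: "chord_diagram C" and b: "parity_framing C \<phi> b"
  shows "left_side C \<phi> a t l (length C) = l"
  using sum_jump[OF C b, of 0 "length C" a t] even_length_chord_diagram[OF C]
    sum_all_positions[OF C, of "\<lambda>x. adj_apply C a x + (1 + b x) * a x"]
  by (simp add: left_side_def lessThan_atLeast0)

text \<open>When \<open>b\<close> encodes a colouring, the second summand is its colour form. Bits
  replace colours to allow ring calculations.\<close>

definition framing_form :: "'b list \<Rightarrow> ('b \<Rightarrow> bit) \<Rightarrow> 'b \<Rightarrow> 'b \<Rightarrow> bit" where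
  "framing_form C b x y = rosenstiehl_form (interlace_graph C) x y +
     adjacency (interlace_graph C) x y * (b x + b y)"

text \<open>Applying the square of the adjacency matrix is applying it twice. One factor of
  adjacency can thus be pulled out of all terms, which gives the shape of
  \<open>sum_between_occurrences\<close>.\<close>

lemma sum_framing_form:
  "(\<Sum>y\<in>set C. framing_form C b x y * a y) =
    (\<Sum>y\<in>set C. adjacency (interlace_graph C) x y * (adj_apply C a y + (b x + 1 + b y) * a y))"
proof -
  let ?e = "adjacency (interlace_graph C)"
  have "(\<Sum>y\<in>set C. (\<Sum>z\<in>set C. ?e x z * ?e z y) * a y) = (\<Sum>z\<in>set C. ?e x z * adj_apply C a z)"
    unfolding adj_apply_def sum_distrib_left sum_distrib_right mult.assoc
    by (rule sum.swap)
  moreover have "pverts (interlace_graph C) = set C" by (simp add: interlace_graph_def)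
  ultimately show ?thesis
    by (simp add: framing_form_def rosenstiehl_form_def distrib_left distrib_right sum.distrib
        mult.assoc add.assoc add.left_commute add.commute)
qed

text \<open>
  The left labels before \<open>x\<^sub>\<infinity>\<close> and after \<open>x\<^sub>0\<close> belong to the same corner, and they differ by the
  intersection number modulo 2 of the cycle with one of the two lobes at \<open>x\<close>. The form of the
  framing is thus the intersection form of the lobes.
\<close>

lemma left_side_lobe:
  assumes C: "chord_diagram C" and even: "even_degrees (interlace_graph C)"
    and b: "parity_framing C \<phi> b" and i: "i < length C" "\<phi> i = Infty"
  shows "left_side C \<phi> a t l (Suc (other_occurrence C i)) + left_side C \<phi> a t l i =
    (\<Sum>y\<in>set C. framing_form C b (C ! i) y * a y)"
proof -
  define j where "j = other_occurrence C i"
  define g where "g y = adj_apply C a y + (b (C ! i) + 1 + b y) * a y" for y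
  note o = other_occurrence[OF C i(1), folded j_def]
  have "of_nat i + of_bool (\<phi> i = Zero) = b (C ! i)"
    using b i(1) by (simp add: parity_framing_def)
  then have bi: "b (C ! i) = of_nat i" using i(2) by simp
  show ?thesis
  proof (cases "i < j")
    case True
    have parity: "of_nat i = (of_nat (Suc j) :: bit)"
      using occurrences_opposite_parity[OF C even True] o by simp
    \<comment> \<open>The endpoints carry the same chord, so their summands cancel and only the
      positions strictly between them remain.\<close>
    have ij: "{i..<Suc j} = insert i (insert j {i<..<j})" using True by auto
    have "left_side C \<phi> a t l (Suc j) + left_side C \<phi> a t l i = (\<Sum>m\<in>{i..<Suc j}. jump C \<phi> a t m)"
      using left_side_add[of i "Suc j" C \<phi> a t l] True by (simp add: ac_simps)
    also have "\<dots> = (\<Sum>m\<in>{i..<Suc j}. g (C ! m))"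
      using sum_jump[OF C b _ _ parity, of a t] True o by (simp add: g_def bi)
    also have "\<dots> = (\<Sum>m\<in>{i<..<j}. g (C ! m))"
      unfolding ij using o by simp
    also have "\<dots> = (\<Sum>y\<in>set C. adjacency (interlace_graph C) (C ! i) y * g y)"
      using sum_between_occurrences[OF C True] o by simp
    finally show ?thesis by (simp add: sum_framing_form g_def j_def)
  next
    case False
    then have ji: "j < i" using o by simp
    have parity: "of_nat (Suc j) = (of_nat i :: bit)"
      using occurrences_opposite_parity[OF C even ji i(1)] o by simp
    \<comment> \<open>In this order the interval already omits both occurrences of the
      chord.\<close>
    have ij: "{Suc j..<i} = {j<..<i}" by auto
    have "left_side C \<phi> a t l (Suc j) + left_side C \<phi> a t l i = (\<Sum>m\<in>{Suc j..<i}. jump C \<phi> a t m)"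
      using left_side_add[of "Suc j" i C \<phi> a t l] ji by (simp add: ac_simps)
    also have "\<dots> = (\<Sum>m\<in>{Suc j..<i}. g (C ! m))"
      unfolding g_def bi parity[symmetric]
      using sum_jump[OF C b _ _ parity, of a t] ji i(1) by (simp del: of_nat_Suc)
    also have "\<dots> = (\<Sum>y\<in>set C. adjacency (interlace_graph C) (C ! i) y * g y)"
      unfolding ij using sum_between_occurrences[OF C ji i(1)] o by simp
    finally show ?thesis by (simp add: sum_framing_form g_def j_def)
  qed
qed

section \<open>Regions and the genus of a framing\<close>

lemma finite_half_edges: "finite (half_edges C)"
proof -
  have "(UNIV :: sign set) = {Pos, Neg}" using sign.exhaust by blast
  then have "finite (UNIV :: sign set)" by (metis finite.emptyI finite.insertI)
  then show ?thesis by (simp add: half_edges_def)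
qed

lemma across_band_eq:
  assumes "i < length C"
  shows across_band_Pos: "across_band C (i, Pos) = (if Suc i = length C then 0 else Suc i, Neg)"
    and across_band_Neg: "across_band C (i, Neg) = (if i = 0 then length C - 1 else i - 1, Pos)"
proof -
  show "across_band C (i, Pos) = (if Suc i = length C then 0 else Suc i, Neg)"
    using assms by auto
  show "across_band C (i, Neg) = (if i = 0 then length C - 1 else i - 1, Pos)"
    using assms by (cases i) auto
qed

declare across_band.simps [simp del]

lemma across_band_half_edges: "h \<in> half_edges C \<Longrightarrow> across_band C h \<in> half_edges C"
  by (cases h; cases "snd h")
    (auto simp: half_edges_def across_band_eq)

lemma disc_next_half_edges:
  "chord_diagram C \<Longrightarrow> h \<in> half_edges C \<Longrightarrow> disc_next C \<phi> h \<in> half_edges C"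
  by (cases h) (auto simp: half_edges_def other_occurrence_less)

lemma face_map_half_edges:
  "chord_diagram C \<Longrightarrow> (across_band C \<circ> disc_next C \<phi>) ` half_edges C \<subseteq> half_edges C"
  by (auto intro!: across_band_half_edges disc_next_half_edges simp del: disc_next.simps)

lemma inj_on_across_band: "inj_on (across_band C) (half_edges C)"
proof (rule inj_onI)
  fix h h' assume h: "h \<in> half_edges C" "h' \<in> half_edges C" and eq: "across_band C h = across_band C h'"
  obtain i s j u where "h = (i, s)" "h' = (j, u)" by (cases h, cases h')
  then show "h = h'"
    using h eq by (cases s; cases u)
      (auto simp: half_edges_def across_band_eq split: if_splits)
qed

lemma inj_on_disc_next:
  assumes C: "chord_diagram C"
  shows "inj_on (disc_next C \<phi>) (half_edges C)"
proof (rule inj_onI)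
  fix h h' assume h: "h \<in> half_edges C" "h' \<in> half_edges C" and eq: "disc_next C \<phi> h = disc_next C \<phi> h'"
  obtain i s j u where hs: "h = (i, s)" "h' = (j, u)" by (cases h, cases h')
  then have ij: "i < length C" "j < length C" "other_occurrence C i = other_occurrence C j"
    using h eq by (auto simp: half_edges_def)
  then have "i = j"
    using other_occurrence_other[OF C] by metis
  then show "h = h'"
    using hs eq by (cases s; cases u; cases "\<phi> i") auto
qed

lemma inj_on_face_map:
  assumes C: "chord_diagram C"
  shows "inj_on (across_band C \<circ> disc_next C \<phi>) (half_edges C)"
  using inj_on_disc_next[OF C] disc_next_half_edges[OF C]
  by (intro comp_inj_on inj_on_subset[OF inj_on_across_band]) auto

text \<open>
  A half-edge \<open>h\<close> stands for the corner between \<open>h\<close> and the next half-edge of its disc: the region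
  on the left of the outgoing edge for \<open>Pos\<close>, on the right of the incoming edge for \<open>Neg\<close>.
\<close>

definition corner_function :: "'b list \<Rightarrow> (nat \<Rightarrow> bit) \<Rightarrow> (nat \<Rightarrow> bit) \<Rightarrow> nat \<times> sign \<Rightarrow> bit" where
  "corner_function C L D = (\<lambda>(k, s). if k < length C then
     case s of Pos \<Rightarrow> L (Suc k) | Neg \<Rightarrow> L k + D k else 0)"

text \<open>Here \<open>L\<close> is the label on the left of an edge and \<open>L + D\<close> the
  label on its right. Each equation compares, at one of the four corners of the disc, the labels
  read from the two edges adjacent to that corner.\<close>

definition face_equations ::
    "'b list \<Rightarrow> (nat \<Rightarrow> level) \<Rightarrow> (nat \<Rightarrow> bit) \<Rightarrow> (nat \<Rightarrow> bit) \<Rightarrow> bool" where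
  "face_equations C \<phi> L D \<longleftrightarrow> (\<forall>i<length C. \<phi> i = Infty \<longrightarrow> (let j = other_occurrence C i in
     L (Suc i) = L (Suc j) + D (Suc j) \<and> L j = L i + D i \<and>
     L (Suc j) = L i \<and> L (Suc i) + D (Suc i) = L j + D j))"

definition invariants :: "'b list \<Rightarrow> (nat \<Rightarrow> level) \<Rightarrow> (nat \<times> sign \<Rightarrow> bit) set" where
  "invariants C \<phi> = {h \<in> bit_funs (half_edges C).
     \<forall>x\<in>half_edges C. h ((across_band C \<circ> disc_next C \<phi>) x) = h x}"

text \<open>Occurrence \<open>i\<close> has incoming edge \<open>i\<close> and outgoing edge
  \<open>Suc i\<close>, and the indices \<open>0\<close> and \<open>length C\<close> denote the same
  edge. Periodicity makes the formulas uniform at this seam.\<close>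

lemma corner_function_across_band:
  assumes "L (length C) = L 0" and "D (length C) = D 0" and i: "i < length C"
  shows "corner_function C L D (across_band C (i, Pos)) = L (Suc i) + D (Suc i)"
    and "corner_function C L D (across_band C (i, Neg)) = L i"
proof -
  have "0 < length C" using i by linarith
  then show "corner_function C L D (across_band C (i, Pos)) = L (Suc i) + D (Suc i)"
    using assms by (auto simp: corner_function_def across_band_eq)
  show "corner_function C L D (across_band C (i, Neg)) = L i"
    using assms \<open>0 < length C\<close> by (auto simp: corner_function_def across_band_eq)
qed

lemma ball_half_edges:
  "(\<forall>x\<in>half_edges C. P x) \<longleftrightarrow> (\<forall>i<length C. P (i, Pos) \<and> P (i, Neg))"
proof -
  have "P (i, Pos) \<and> P (i, Neg) \<Longrightarrow> P (i, s)" for i s by (cases s) auto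
  then show ?thesis unfolding half_edges_def by blast
qed

lemma framing_other_occurrence:
  assumes C: "chord_diagram C" and \<phi>: "framing C \<phi>" and i: "i < length C"
  shows "\<phi> (other_occurrence C i) \<noteq> \<phi> i"
  using \<phi>[unfolded framing_def] other_occurrence(1-3)[OF C i] i by (metis linorder_neqE_nat)

lemma corner_function_invariants_iff:
  assumes C: "chord_diagram C" and \<phi>: "framing C \<phi>"
    and per: "L (length C) = L 0" "D (length C) = D 0"
  shows "corner_function C L D \<in> invariants C \<phi> \<longleftrightarrow> face_equations C \<phi> L D"
proof -
  let ?h = "corner_function C L D"
  \<comment> \<open>\<open>?P k\<close> is invariance at the two half-edges of occurrence
    \<open>k\<close>. Pairing an occurrence at level \<open>Infty\<close> with its partner collects
    the four equations of a disc.\<close>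
  let ?P = "\<lambda>k. case \<phi> k of
      Infty \<Rightarrow> L (Suc k) = L (Suc (other_occurrence C k)) + D (Suc (other_occurrence C k)) \<and>
        L (other_occurrence C k) = L k + D k
    | Zero \<Rightarrow> L (Suc k) = L (other_occurrence C k) \<and>
        L (Suc (other_occurrence C k)) + D (Suc (other_occurrence C k)) = L k + D k"
  have "?h ((across_band C \<circ> disc_next C \<phi>) (k, Pos)) = ?h (k, Pos) \<and>
      ?h ((across_band C \<circ> disc_next C \<phi>) (k, Neg)) = ?h (k, Neg) \<longleftrightarrow> ?P k"
    if k: "k < length C" for k
  proof -
    note corner = corner_function_across_band[OF per other_occurrence_less[OF C k]]
    have "?h (k, Pos) = L (Suc k)" "?h (k, Neg) = L k + D k"
      using k by (simp_all add: corner_function_def)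
    then show ?thesis
      by (cases "\<phi> k") (auto simp: corner)
  qed
  moreover have "?h \<in> bit_funs (half_edges C)"
    by (auto simp: bit_funs_def half_edges_def corner_function_def)
  ultimately have "?h \<in> invariants C \<phi> \<longleftrightarrow> (\<forall>k<length C. ?P k)"
    unfolding invariants_def ball_half_edges by blast
  also have "\<dots> \<longleftrightarrow> (\<forall>i<length C. \<phi> i = Infty \<longrightarrow> ?P i \<and> ?P (other_occurrence C i))"
  proof (intro iffI allI impI)
    fix k assume *: "\<forall>i<length C. \<phi> i = Infty \<longrightarrow> ?P i \<and> ?P (other_occurrence C i)" and k: "k < length C"
    show "?P k"
    proof (cases "\<phi> k")
      case Infty
      then show ?thesis using * k by blast
    next
      case Zero
      then have "\<phi> (other_occurrence C k) = Infty"
        using framing_other_occurrence[OF C \<phi> k] level.exhaust by metis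
      then show ?thesis
        using * other_occurrence_less[OF C k] other_occurrence_other[OF C k] by metis
    qed
  qed (use other_occurrence_less[OF C] in blast)
  also have "\<dots> \<longleftrightarrow> face_equations C \<phi> L D"
  proof -
    have "?P i \<and> ?P (other_occurrence C i) \<longleftrightarrow> (let j = other_occurrence C i in
        L (Suc i) = L (Suc j) + D (Suc j) \<and> L j = L i + D i \<and>
        L (Suc j) = L i \<and> L (Suc i) + D (Suc i) = L j + D j)"
      if i: "i < length C" "\<phi> i = Infty" for i
    proof -
      have "\<phi> (other_occurrence C i) = Zero"
        using framing_other_occurrence[OF C \<phi> i(1)] i(2) level.exhaust by metis
      then show ?thesis using i other_occurrence_other[OF C i(1)] by (simp add: Let_def)
    qed
    then show ?thesis unfolding face_equations_def by blast
  qed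
  finally show ?thesis .
qed

text \<open>The parameters are the changes \<open>a\<close> at the double points, the chain
  \<open>t\<close> on edge \<open>0\<close> and the label \<open>l\<close> on the left of edge
  \<open>0\<close>.\<close>

definition chain_corner_function ::
    "'b list \<Rightarrow> (nat \<Rightarrow> level) \<Rightarrow> ('b \<Rightarrow> bit) \<times> bit \<times> bit \<Rightarrow> nat \<times> sign \<Rightarrow> bit" where
  "chain_corner_function C \<phi> =
     (\<lambda>(a, t, l). corner_function C (left_side C \<phi> a t l) (edge_chain C a t))"

lemma corner_function_cong:
  assumes "\<And>k. k \<le> length C \<Longrightarrow> L k = L' k" and "\<And>k. k \<le> length C \<Longrightarrow> D k = D' k"
  shows "corner_function C L D = corner_function C L' D'"
  using assms by (auto simp: corner_function_def fun_eq_iff split: sign.splits)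

lemma corner_function_eqD:
  assumes eq: "corner_function C L D = corner_function C L' D'"
    and per: "L (length C) = L 0" "L' (length C) = L' 0" "D (length C) = D 0" "D' (length C) = D' 0"
    and C: "C \<noteq> []" and k: "k \<le> length C"
  shows "L k = L' k \<and> D k = D' k"
proof -
  have Suc: "L (Suc k) = L' (Suc k)" and Neg: "L k + D k = L' k + D' k" if "k < length C" for k
    using that fun_cong[OF eq, of "(k, Pos)"] fun_cong[OF eq, of "(k, Neg)"]
    by (auto simp: corner_function_def)
  have L: "L k = L' k" if "k \<le> length C" for k
  proof (cases k)
    \<comment> \<open>The left label of edge \<open>0\<close> is visible only as that of edge
      \<open>length C\<close>, at the last occurrence.\<close>
    case 0
    then show ?thesis using Suc[of "length C - 1"] C per by simp
  next
    case (Suc n)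
    then show ?thesis using Suc that \<open>\<And>k. k < length C \<Longrightarrow> L (Suc k) = L' (Suc k)\<close> by simp
  qed
  moreover have "D k = D' k" if "k < length C" for k
    using Neg[OF that] L[of k] that by simp
  ultimately show ?thesis
    using k C per by (cases "k = length C") auto
qed

text \<open>The recursions for \<open>left_side\<close> and \<open>edge_chain\<close> make all four
  equations of a disc equivalent to \<open>?L (Suc j) = ?L i\<close>. By
  \<open>left_side_lobe\<close> this is one row of the kernel condition, and every chord has an
  occurrence at level \<open>Infty\<close>.\<close>

lemma face_equations_chain_iff:
  assumes C: "chord_diagram C" and even: "even_degrees (interlace_graph C)"
    and b: "parity_framing C \<phi> b" and a: "a \<in> bit_funs (set C)"
  shows "face_equations C \<phi> (left_side C \<phi> a t l) (edge_chain C a t) \<longleftrightarrow>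
    a \<in> bit_kernel (set C) (framing_form C b)"
proof -
  let ?L = "left_side C \<phi> a t l" and ?D = "edge_chain C a t"
  have \<phi>: "framing C \<phi>" using b by (simp add: parity_framing_def)
  have "(let j = other_occurrence C i in
        ?L (Suc i) = ?L (Suc j) + ?D (Suc j) \<and> ?L j = ?L i + ?D i \<and>
        ?L (Suc j) = ?L i \<and> ?L (Suc i) + ?D (Suc i) = ?L j + ?D j) \<longleftrightarrow>
      (\<Sum>y\<in>set C. framing_form C b (C ! i) y * a y) = 0"
    if i: "i < length C" "\<phi> i = Infty" for i
  proof -
    define j where "j = other_occurrence C i"
    note o = other_occurrence(1-3,5)[OF C i(1), folded j_def]
    have "\<phi> j = Zero"
      using framing_other_occurrence[OF C \<phi> i(1)] i(2) level.exhaust unfolding j_def by metis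
    then have jump: "jump C \<phi> a t i = ?D (Suc j)" "jump C \<phi> a t j = ?D i"
      using i o by (simp_all add: jump_def j_def)
    have "?L (Suc j) + ?L i = (\<Sum>y\<in>set C. framing_form C b (C ! i) y * a y)"
      using left_side_lobe[OF C even b i] by (simp add: j_def)
    moreover have "(?L (Suc i) = ?L (Suc j) + ?D (Suc j) \<and> ?L j = ?L i + ?D i \<and>
        ?L (Suc j) = ?L i \<and> ?L (Suc i) + ?D (Suc i) = ?L j + ?D j) \<longleftrightarrow> ?L (Suc j) + ?L i = 0"
      unfolding left_side_Suc jump edge_chain_Suc o
      by (cases "?L i"; cases "?L j"; cases "?D i"; cases "?D j"; cases "a (C ! i)") simp_all
    ultimately show ?thesis by (simp add: Let_def flip: j_def)
  qed
  then have "face_equations C \<phi> ?L ?D \<longleftrightarrow>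
    (\<forall>i<length C. \<phi> i = Infty \<longrightarrow> (\<Sum>y\<in>set C. framing_form C b (C ! i) y * a y) = 0)"
    unfolding face_equations_def by blast
  also have "\<dots> \<longleftrightarrow> (\<forall>x\<in>set C. (\<Sum>y\<in>set C. framing_form C b x y * a y) = 0)"
  proof (intro iffI ballI)
    fix x assume *: "\<forall>i<length C. \<phi> i = Infty \<longrightarrow> (\<Sum>y\<in>set C. framing_form C b (C ! i) y * a y) = 0"
      and "x \<in> set C"
    then obtain i where i: "i < length C" "C ! i = x" by (auto simp: in_set_conv_nth)
    obtain k where "k < length C" "C ! k = x" "\<phi> k = Infty"
    proof (cases "\<phi> i")
      case Infty
      then show ?thesis using that i by blast
    next
      case Zero
      then have "\<phi> (other_occurrence C i) = Infty"
        using framing_other_occurrence[OF C \<phi> i(1)] level.exhaust by metis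
      then show ?thesis
        using that other_occurrence_less[OF C i(1)] nth_other_occurrence[OF C i(1)] i by metis
    qed
    then show "(\<Sum>y\<in>set C. framing_form C b x y * a y) = 0" using * by blast
  qed simp
  finally show ?thesis using a by (simp add: bit_kernel_def)
qed

text \<open>The labels and the chain can be read off a corner function, and the increments of the
  chain recover \<open>a\<close>. The two free bits account for the 2 in the Euler
  characteristic.\<close>

lemma bij_betw_kernel_invariants:
  assumes C: "chord_diagram C" and ne: "C \<noteq> []" and even: "even_degrees (interlace_graph C)"
    and b: "parity_framing C \<phi> b"
  shows "bij_betw (chain_corner_function C \<phi>)
    (bit_kernel (set C) (framing_form C b) \<times> UNIV \<times> UNIV) (invariants C \<phi>)"
proof -
  let ?K = "bit_kernel (set C) (framing_form C b)"
  have \<phi>: "framing C \<phi>" using b by (simp add: parity_framing_def)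
  have per: "left_side C \<phi> a t l (length C) = left_side C \<phi> a t l 0"
    "edge_chain C a t (length C) = edge_chain C a t 0" for a t l
    using left_side_length[OF C b] edge_chain_length[OF C]
    by (simp_all add: left_side_def edge_chain_def)
  have iff: "chain_corner_function C \<phi> (a, t, l) \<in> invariants C \<phi> \<longleftrightarrow> a \<in> ?K"
    if "a \<in> bit_funs (set C)" for a t l
    using corner_function_invariants_iff[OF C \<phi> per(1)[of a t l] per(2)[of a t]] face_equations_chain_iff[OF C even b that]
    by (simp add: chain_corner_function_def)
  show ?thesis
    unfolding bij_betw_def
  proof (intro conjI subset_antisym)
    show "inj_on (chain_corner_function C \<phi>) (?K \<times> UNIV \<times> UNIV)"
    proof (rule inj_onI)
      fix z z' assume z: "z \<in> ?K \<times> UNIV \<times> UNIV" "z' \<in> ?K \<times> UNIV \<times> UNIV"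
        and zz': "chain_corner_function C \<phi> z = chain_corner_function C \<phi> z'"
      obtain a t l a' t' l' where z_eq: "z = (a, t, l)" "z' = (a', t', l')"
        using prod_cases3 by metis
      have a: "a \<in> ?K" "a' \<in> ?K" using z z_eq by auto
      have eq: "chain_corner_function C \<phi> (a, t, l) = chain_corner_function C \<phi> (a', t', l')"
        using zz' z_eq by simp
      have *: "left_side C \<phi> a t l k = left_side C \<phi> a' t' l' k \<and> edge_chain C a t k = edge_chain C a' t' k"
        if "k \<le> length C" for k
        using corner_function_eqD[OF eq[unfolded chain_corner_function_def prod.case] per(1) per(1) per(2) per(2) ne that] .
      have "t = t'" "l = l'" using *[of 0] by (simp_all add: left_side_def edge_chain_def)
      moreover have "a (C ! k) = a' (C ! k)" if "k < length C" for k
        using *[of k] *[of "Suc k"] that by (simp add: edge_chain_Suc)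
      then have "a y = a' y" for y
        using a by (cases "y \<in> set C") (auto simp: bit_kernel_def bit_funs_def in_set_conv_nth)
      ultimately show "z = z'" unfolding z_eq by auto
    qed
    show "chain_corner_function C \<phi> ` (?K \<times> UNIV \<times> UNIV) \<subseteq> invariants C \<phi>"
      using iff by (auto simp: bit_kernel_def)
    show "invariants C \<phi> \<subseteq> chain_corner_function C \<phi> ` (?K \<times> UNIV \<times> UNIV)"
    proof
      fix h assume h: "h \<in> invariants C \<phi>"
      \<comment> \<open>Edge \<open>k\<close> leaves occurrence \<open>k - 1\<close>, and edge
        \<open>0\<close> leaves the last one, whose positive corner lies on its left.
        \<open>D\<close> is then the sum of the labels on both sides.\<close>
      define L where "L k = h (if k = 0 then length C - 1 else k - 1, Pos)" for k
      define D where "D k = (if k < length C then h (k, Neg) + L k else h (0, Neg) + L 0)" for k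
      have L_per: "L (length C) = L 0" and D_per: "D (length C) = D 0"
        using ne by (simp_all add: L_def D_def)
      have "corner_function C L D x = h x" for x
      proof (cases "x \<in> half_edges C")
        case True
        then show ?thesis
          by (cases x; cases "snd x")
            (auto simp: half_edges_def corner_function_def L_def D_def add.left_commute)
      next
        case False
        then have "h x = 0" using h unfolding invariants_def bit_funs_def by blast
        then show ?thesis using False
          by (auto simp: half_edges_def corner_function_def split: prod.splits)
      qed
      then have h_eq: "h = corner_function C L D" by auto
      then have "face_equations C \<phi> L D"
        using h corner_function_invariants_iff[OF C \<phi> L_per D_per] by simp
      then have eqs: "L (Suc i) = L (Suc (other_occurrence C i)) + D (Suc (other_occurrence C i))"
        "L (other_occurrence C i) = L i + D i"
        "L (Suc (other_occurrence C i)) = L i"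
        "L (Suc i) + D (Suc i) = L (other_occurrence C i) + D (other_occurrence C i)"
        if "i < length C" "\<phi> i = Infty" for i
        using that unfolding face_equations_def Let_def by blast+
      \<comment> \<open>Conversely, the face equations force the recursion of
        \<open>left_side\<close> and make the chain change by the same amount at both occurrences of
        a chord.\<close>
      have eqs': "L (Suc k) = L k + D (case \<phi> k of Infty \<Rightarrow> Suc (other_occurrence C k) | Zero \<Rightarrow> other_occurrence C k)"
        "D (Suc (other_occurrence C k)) + D (other_occurrence C k) = D (Suc k) + D k"
        if k: "k < length C" for k
      proof -
        have "L (Suc k) = L k + D (case \<phi> k of Infty \<Rightarrow> Suc (other_occurrence C k) | Zero \<Rightarrow> other_occurrence C k) \<and>
          D (Suc (other_occurrence C k)) + D (other_occurrence C k) = D (Suc k) + D k"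
        proof (cases "\<phi> k")
          case Infty
          define j where "j = other_occurrence C k"
          show ?thesis
            using eqs[OF k Infty, folded j_def]
            unfolding Infty level.case j_def[symmetric]
            by (cases "L k"; cases "D k"; cases "L (Suc k)"; cases "D (Suc k)";
                cases "D j"; cases "D (Suc j)"; cases "L j"; cases "L (Suc j)") simp_all
        next
          case Zero
          define j where "j = other_occurrence C k"
          have "\<phi> j = Infty" "j < length C" "other_occurrence C j = k"
            using Zero framing_other_occurrence[OF C \<phi> k] level.exhaust
              other_occurrence_less[OF C k] other_occurrence_other[OF C k] unfolding j_def by metis+
          then show ?thesis
            using eqs[of j]
            unfolding Zero level.case j_def[symmetric]
            by (cases "L k"; cases "D k"; cases "L (Suc k)"; cases "D (Suc k)";
                cases "D j"; cases "D (Suc j)"; cases "L j"; cases "L (Suc j)") simp_all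
        qed
        then show "L (Suc k) = L k + D (case \<phi> k of Infty \<Rightarrow> Suc (other_occurrence C k) | Zero \<Rightarrow> other_occurrence C k)"
          "D (Suc (other_occurrence C k)) + D (other_occurrence C k) = D (Suc k) + D k" by auto
      qed
      \<comment> \<open>Any occurrence may be chosen, since both give the same increment of
        \<open>D\<close>.\<close>
      define p where "p y = (SOME k. k < length C \<and> C ! k = y)" for y
      define a where "a y = (if y \<in> set C then D (Suc (p y)) + D (p y) else 0)" for y
      have a: "a (C ! k) = D (Suc k) + D k" if k: "k < length C" for k
      proof -
        have "p (C ! k) < length C \<and> C ! p (C ! k) = C ! k"
          unfolding p_def using k by (rule_tac someI[of _ k]) simp
        then have "p (C ! k) = k \<or> p (C ! k) = other_occurrence C k"
          using occurrence_cases[OF C k] by blast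
        then show ?thesis using eqs'(2)[OF k] k by (auto simp: a_def)
      qed
      have D_eq: "edge_chain C a (D 0) k = D k" if "k \<le> length C" for k
        using that by (induction k) (simp_all add: edge_chain_Suc a add.left_commute, simp add: edge_chain_def)
      have L_eq: "left_side C \<phi> a (D 0) (L 0) k = L k" if "k \<le> length C" for k
        using that
      proof (induction k)
        case 0
        then show ?case by (simp add: left_side_def)
      next
        case (Suc k)
        then show ?case
          using eqs'(1)[of k] other_occurrence_less[OF C, of k]
          by (cases "\<phi> k") (simp_all add: left_side_Suc jump_def D_eq)
      qed
      have "h = chain_corner_function C \<phi> (a, D 0, L 0)"
        unfolding h_eq chain_corner_function_def prod.case
        by (rule corner_function_cong) (simp_all add: D_eq L_eq)
      moreover have "a \<in> bit_funs (set C)" by (simp add: bit_funs_def a_def)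
      ultimately show "h \<in> chain_corner_function C \<phi> ` (?K \<times> UNIV \<times> UNIV)"
        using iff h by auto
    qed
  qed
qed

lemma adjacency_interlace_graph_sym:
  "adjacency (interlace_graph C) x y = adjacency (interlace_graph C) y x"
  using parcs_sym[OF pair_graph_interlace_graph, of x y] by (simp add: adjacency_def)

lemma framing_form_sym: "framing_form C b x y = framing_form C b y x"
proof -
  let ?e = "adjacency (interlace_graph C)"
  have "?e x z * ?e z y = ?e y z * ?e z x" for z
    using adjacency_interlace_graph_sym[of C x z] adjacency_interlace_graph_sym[of C z y]
    by (simp add: mult.commute)
  then show ?thesis
    using adjacency_interlace_graph_sym[of C x y]
    by (simp add: framing_form_def rosenstiehl_form_def add.commute)
qed

text \<open>The invariant functions number 2 to the power of the boundary components, and also four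
  times the size of the kernel. With rank and nullity, comparing exponents determines the
  genus.\<close>

lemma genus_eq_half_rank:
  assumes C: "chord_diagram C" and even: "even_degrees (interlace_graph C)"
    and b: "parity_framing C \<phi> b"
  shows "genus C \<phi> = real (matrix_rank (set C) (framing_form C b)) / 2"
proof -
  let ?K = "bit_kernel (set C) (framing_form C b)" and ?r = "matrix_rank (set C) (framing_form C b)"
  have rank: "card ?K * 2 ^ ?r = 2 ^ card (set C)"
    by (rule rank_nullity_bit) (simp_all add: framing_form_sym[of C b])
  have "boundary_components C \<phi> + ?r = card (set C) + 2"
  proof (cases "C = []")
    \<comment> \<open>Without chords the rank is 0, which fits the convention of two boundary
      components.\<close>
    case True
    then show ?thesis using rank by (simp add: boundary_components_def)
  next
    case False
    have "2 ^ boundary_components C \<phi> = card (invariants C \<phi>)"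
      using card_invariant_bit_funs[OF finite_half_edges inj_on_face_map[OF C] face_map_half_edges[OF C]]
        False by (simp add: boundary_components_def invariants_def)
    also have "\<dots> = card ?K * 4"
      using bij_betw_same_card[OF bij_betw_kernel_invariants[OF C False even b]]
      by (simp add: card_cartesian_product card_UNIV_bit flip: UNIV_Times_UNIV)
    finally have "2 ^ (boundary_components C \<phi> + ?r) = (2 :: nat) ^ (card (set C) + 2)"
      using rank by (simp add: power_add)
    then show ?thesis by (simp only: power_inject_exp)
  qed
  then have "real (boundary_components C \<phi>) + real ?r = real (card (set C)) + 2"
    by (metis of_nat_add of_nat_numeral)
  then show ?thesis by (simp add: genus_def)
qed

section \<open>Minimal genus\<close>

definition colour_bit :: "('a \<Rightarrow> colour) \<Rightarrow> 'a \<Rightarrow> bit" where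
  "colour_bit \<chi> x = of_bool (\<chi> x = Black)"

lemma colour_form_eq: "colour_form G \<chi> x y = adjacency G x y * (colour_bit \<chi> x + colour_bit \<chi> y)"
  by (cases "\<chi> x"; cases "\<chi> y") (simp_all add: colour_form_def adjacency_def colour_bit_def)

lemma framing_form_colour_bit:
  "framing_form C (colour_bit \<chi>) =
    rosenstiehl_form (interlace_graph C) + colour_form (interlace_graph C) \<chi>"
  by (simp add: fun_eq_iff framing_form_def colour_form_eq)

lemma ex_colour_bit: "\<exists>\<chi>. colour_bit \<chi> = b"
proof
  show "colour_bit (\<lambda>x. if b x = 1 then Black else White) = b"
  proof
    show "colour_bit (\<lambda>x. if b x = 1 then Black else White) x = b x" for x
      by (cases "b x") (simp_all add: colour_bit_def)
  qed
qed

lemma Collect_colour_bit: "{F b | b. True} = {F (colour_bit \<chi>) | \<chi>. True}"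
proof (intro set_eqI iffI)
  fix z assume "z \<in> {F b | b. True}"
  then obtain b where "z = F b" by blast
  moreover obtain \<chi> where "colour_bit \<chi> = b" using ex_colour_bit by blast
  ultimately show "z \<in> {F (colour_bit \<chi>) | \<chi>. True}" by blast
qed blast

text \<open>The level \<open>Infty\<close> goes to the occurrence whose parity is the prescribed
  bit; there is exactly one for each chord, as its occurrences have opposite parities.\<close>

lemma ex_parity_framing:
  assumes C: "chord_diagram C" and even: "even_degrees (interlace_graph C)"
  shows "\<exists>\<phi>. parity_framing C \<phi> b"
proof -
  define \<phi> where "\<phi> m = (if of_nat m = b (C ! m) then Infty else Zero)" for m
  have "framing C \<phi>"
    unfolding framing_def
  proof (intro allI impI)
    fix i j assume ij: "i < j \<and> j < length C \<and> C ! i = C ! j"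
    then have "of_nat i = (of_nat (Suc j) :: bit)"
      using occurrences_opposite_parity[OF C even] by blast
    with ij show "\<phi> i \<noteq> \<phi> j"
      by (cases "of_nat j :: bit"; cases "b (C ! j)") (simp_all add: \<phi>_def)
  qed
  moreover have "of_nat m + of_bool (\<phi> m = Zero) = b (C ! m)" for m
    by (cases "of_nat m :: bit"; cases "b (C ! m)") (simp_all add: \<phi>_def)
  ultimately show ?thesis unfolding parity_framing_def by blast
qed

text \<open>Between the two occurrences of a chord both the parity and the level change, so their
  sum depends on the chord alone.\<close>

lemma framing_imp_ex_parity_framing:
  assumes C: "chord_diagram C" and even: "even_degrees (interlace_graph C)" and \<phi>: "framing C \<phi>"
  shows "\<exists>b. parity_framing C \<phi> b"
proof -
  define f where "f m = (of_nat m + of_bool (\<phi> m = Zero) :: bit)" for m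
  have less: "f i = f j" if "i < j" "j < length C" "C ! i = C ! j" for i j
  proof -
    have "\<phi> i \<noteq> \<phi> j" using \<phi> that by (auto simp: framing_def)
    moreover have "of_nat i = (of_nat (Suc j) :: bit)"
      using occurrences_opposite_parity[OF C even that] .
    ultimately show ?thesis
      by (cases "\<phi> i"; cases "\<phi> j") (simp_all add: f_def)
  qed
  have eq: "f i = f j" if "i < length C" "j < length C" "C ! i = C ! j" for i j
    using less[of i j] less[of j i] that by (metis linorder_neqE_nat)
  define b where "b y = f (SOME m. m < length C \<and> C ! m = y)" for y
  have "f m = b (C ! m)" if m: "m < length C" for m
  proof -
    have "(SOME k. k < length C \<and> C ! k = C ! m) < length C \<and>
      C ! (SOME k. k < length C \<and> C ! k = C ! m) = C ! m"
      using m by (rule_tac someI[of _ m]) simp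
    then show ?thesis unfolding b_def using eq m by metis
  qed
  then show ?thesis using \<phi> unfolding parity_framing_def f_def by blast
qed

lemma minimal_genus_interlace_graph:
  assumes C: "chord_diagram C" and even: "even_degrees (interlace_graph C)"
  shows "minimal_genus C = Min {real (matrix_rank (set C)
    (rosenstiehl_form (interlace_graph C) + colour_form (interlace_graph C) \<chi>)) / 2 | \<chi>. True}"
proof -
  have "{genus C \<phi> | \<phi>. framing C \<phi>} = {real (matrix_rank (set C) (framing_form C b)) / 2 | b. True}"
    using ex_parity_framing[OF C even] framing_imp_ex_parity_framing[OF C even]
      genus_eq_half_rank[OF C even]
    unfolding parity_framing_def by (intro Collect_cong) metis
  also have "\<dots> = {real (matrix_rank (set C) (framing_form C (colour_bit \<chi>))) / 2 | \<chi>. True}"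
    by (rule Collect_colour_bit)
  finally show ?thesis by (simp add: minimal_genus_def framing_form_colour_bit)
qed

lemma Min_half_rank:
  fixes M :: "'c \<Rightarrow> 'a \<Rightarrow> 'a \<Rightarrow> bit"
  assumes "finite V"
  shows "Min {real (matrix_rank V (M c)) / 2 | c. True} = 1 / 2 * real (Min {matrix_rank V (M c) | c. True})"
proof -
  have "{matrix_rank V (M c) | c. True} \<subseteq> {..card V}"
    using matrix_rank_le_card[OF assms] by auto
  then have "finite {matrix_rank V (M c) | c. True}" using finite_subset by blast
  moreover have "mono (\<lambda>r :: nat. real r / 2)" by (simp add: mono_def)
  moreover have "{real (matrix_rank V (M c)) / 2 | c. True} = (\<lambda>r. real r / 2) ` {matrix_rank V (M c) | c. True}"
    by auto
  ultimately show ?thesis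
    using mono_Min_commute[of "\<lambda>r :: nat. real r / 2" "{matrix_rank V (M c) | c. True}"] by fastforce
qed

lemma matrix_rank_cong:
  assumes "\<And>x y. x \<in> V \<Longrightarrow> y \<in> V \<Longrightarrow> M x y = M' x y"
  shows "matrix_rank V M = matrix_rank V M'"
proof -
  have "(\<lambda>x y. if y \<in> V then M x y else 0) ` V = (\<lambda>x y. if y \<in> V then M' x y else 0) ` V"
    using assms by (intro image_cong) auto
  then show ?thesis by (simp add: matrix_rank_def)
qed

text \<open>Replaces an isomorphism of graphs by an equality, at the price of renaming the
  chords.\<close>

lemma has_interlace_graph_relabelling:
  assumes "has_interlace_graph C G"
  obtains f where "inj_on f (set C)" and "interlace_graph (map f C) = G"
proof -
  let ?I = "with_proj (interlace_graph C)"
  from assms obtain h where h: "pre_digraph.digraph_isomorphism ?I h"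
    and G: "with_proj G = app_iso h ?I"
    unfolding has_interlace_graph_def digraph_iso_def by blast
  define f where "f = iso_verts h"
  have inj: "inj_on f (set C)"
    using pre_digraph.digraph_isomorphism_inj_on_verts[OF h] by (simp add: f_def interlace_graph_def)
  have "verts (with_proj G) = f ` set C" "arcs (with_proj G) = iso_arcs h ` parcs (interlace_graph C)"
    and tail: "iso_tail h = fst" and head: "iso_head h = snd"
    using G by (simp_all add: f_def app_iso_def with_proj_def interlace_graph_def)
  then have pverts: "pverts G = f ` set C" and parcs: "parcs G = iso_arcs h ` parcs (interlace_graph C)"
    by simp_all
  \<comment> \<open>Arcs are pairs of vertices, so compatibility with tails and heads determines the
    arc map from the vertex map.\<close>
  have "iso_arcs h (x, y) = (f x, f y)" if "(x, y) \<in> parcs (interlace_graph C)" for x y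
    using pre_digraph.iso_verts_tail[OF h, of "(x, y)"] pre_digraph.iso_verts_head[OF h, of "(x, y)"]
      that tail head by (simp add: f_def prod_eq_iff)
  then have parcs: "parcs G = (\<lambda>(x, y). (f x, f y)) ` parcs (interlace_graph C)"
    unfolding parcs by (intro image_cong) auto
  have map_eq: "map f C ! i = f x \<longleftrightarrow> C ! i = x" if "i < length C" "x \<in> set C" for i x
    using that inj by (simp add: inj_on_eq_iff)
  have interlaced_map: "interlaced (map f C) (f x) (f y) \<longleftrightarrow> interlaced C x y"
    if xy: "x \<in> set C" "y \<in> set C" for x y
  proof -
    have "f x \<noteq> f y \<longleftrightarrow> x \<noteq> y" using inj xy by (simp add: inj_on_eq_iff)
    moreover have "i < j \<and> j < k \<and> k < l \<and> l < length (map f C) \<and>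
        (map f C ! i = f x \<and> map f C ! j = f y \<and> map f C ! k = f x \<and> map f C ! l = f y \<or>
         map f C ! i = f y \<and> map f C ! j = f x \<and> map f C ! k = f y \<and> map f C ! l = f x) \<longleftrightarrow>
      i < j \<and> j < k \<and> k < l \<and> l < length C \<and>
        (C ! i = x \<and> C ! j = y \<and> C ! k = x \<and> C ! l = y \<or>
         C ! i = y \<and> C ! j = x \<and> C ! k = y \<and> C ! l = x)" for i j k l
      using map_eq[OF _ xy(1)] map_eq[OF _ xy(2)] by (auto simp del: nth_map)
    ultimately show ?thesis unfolding interlaced_def by presburger
  qed
  have "interlace_graph (map f C) = G"
  proof (rule pair_pre_digraph.equality)
    show "pverts (interlace_graph (map f C)) = pverts G"
      by (simp add: interlace_graph_def pverts)
    show "parcs (interlace_graph (map f C)) = parcs G"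
    proof (intro set_eqI iffI)
      fix e assume "e \<in> parcs (interlace_graph (map f C))"
      then obtain u v where e: "e = (u, v)" and uv: "interlaced (map f C) u v"
        by (auto simp: interlace_graph_def)
      then have "u \<in> set (map f C)" "v \<in> set (map f C)" by (auto simp: interlaced_def)
      then obtain x y where xy: "x \<in> set C" "y \<in> set C" "u = f x" "v = f y" by auto
      then have "interlaced C x y" using uv interlaced_map by simp
      then show "e \<in> parcs G" unfolding parcs e xy by (auto simp: interlace_graph_def)
    next
      fix e assume "e \<in> parcs G"
      then obtain x y where e: "e = (f x, f y)" and xy: "interlaced C x y"
        by (auto simp: parcs interlace_graph_def)
      then have "x \<in> set C" "y \<in> set C" by (auto simp: interlaced_def)
      then show "e \<in> parcs (interlace_graph (map f C))"
        using xy interlaced_map by (simp add: e interlace_graph_def)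
    qed
  qed simp
  then show thesis using that inj by blast
qed

lemma chord_diagram_map:
  assumes "chord_diagram C" and "inj_on f (set C)"
  shows "chord_diagram (map f C)"
  using assms by (auto simp: chord_diagram_def count_list_inj_map)

text \<open>Framings and the face permutation depend only on which positions carry equal
  letters.\<close>

lemma minimal_genus_map:
  assumes C: "chord_diagram C" and inj: "inj_on f (set C)"
  shows "minimal_genus (map f C) = minimal_genus C"
proof -
  have nth_eq: "map f C ! i = map f C ! j \<longleftrightarrow> C ! i = C ! j" if "i < length C" "j < length C" for i j
    using that inj by (simp add: inj_on_eq_iff)
  have framing: "framing (map f C) \<phi> \<longleftrightarrow> framing C \<phi>" for \<phi>
    unfolding framing_def length_map using nth_eq less_trans by meson
  have half_edges: "half_edges (map f C) = half_edges C"
    by (simp add: half_edges_def)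
  have "(\<lambda>j. j < length C \<and> j \<noteq> i \<and> map f C ! j = map f C ! i) =
      (\<lambda>j. j < length C \<and> j \<noteq> i \<and> C ! j = C ! i)" if "i < length C" for i
    using nth_eq that by blast
  then have other: "other_occurrence (map f C) i = other_occurrence C i" if "i < length C" for i
    using that unfolding other_occurrence_def length_map by presburger
  have across: "across_band (map f C) h = across_band C h" for h
    by (cases h; cases "snd h") (auto simp: across_band.simps)
  \<comment> \<open>The face maps are compared only on half-edges, because
    \<open>other_occurrence\<close> is meaningful only at positions of the list; this suffices as
    half-edges are preserved.\<close>
  have "orbit (across_band (map f C) \<circ> disc_next (map f C) \<phi>) h = orbit (across_band C \<circ> disc_next C \<phi>) h"
    if "h \<in> half_edges C" for h \<phi>
  proof (rule sym, rule orbit_cong0[OF that])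
    show "across_band C \<circ> disc_next C \<phi> \<in> half_edges C \<rightarrow> half_edges C"
      using face_map_half_edges[OF C] by blast
    show "(across_band C \<circ> disc_next C \<phi>) h = (across_band (map f C) \<circ> disc_next (map f C) \<phi>) h"
      if "h \<in> half_edges C" for h
      using that other by (cases h) (auto simp: half_edges_def across)
  qed
  then have "orbit (across_band (map f C) \<circ> disc_next (map f C) \<phi>) ` half_edges C =
      orbit (across_band C \<circ> disc_next C \<phi>) ` half_edges C" for \<phi>
    by (rule image_cong[OF refl])
  then have "boundary_components (map f C) \<phi> = boundary_components C \<phi>" for \<phi>
    by (simp add: boundary_components_def half_edges)
  moreover have "card (set (map f C)) = card (set C)" using inj by (simp add: card_image)
  ultimately show ?thesis by (simp add: minimal_genus_def genus_def framing)
qed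

text \<open>Off the edges the form is the number of common neighbours modulo 2, which on the
  diagonal is the degree. Both are even by assumption, so the form is supported on the
  edges.\<close>

lemma rosenstiehl_cocycle_eq_form:
  assumes G: "pair_graph G" and even: "even_degrees G"
    and common: "\<forall>x\<in>pverts G. \<forall>y\<in>pverts G. x \<noteq> y \<and> (x, y) \<notin> parcs G \<longrightarrow>
      even (card (neighbours G x \<inter> neighbours G y))"
    and xy: "x \<in> pverts G" "y \<in> pverts G"
  shows "rosenstiehl_cocycle G x y = rosenstiehl_form G x y"
proof (cases "(x, y) \<in> parcs G")
  case False
  interpret pair_graph G by fact
  have "pverts G \<inter> {z. (x, z) \<in> parcs G \<and> (z, y) \<in> parcs G} = neighbours G x \<inter> neighbours G y"
    using parcs_sym[OF G, of y] in_arcsD2 by (auto simp: neighbours_def)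
  then have "(\<Sum>z\<in>pverts G. adjacency G x z * adjacency G z y) =
      of_nat (card (neighbours G x \<inter> neighbours G y))"
    by (simp add: adjacency_def flip: of_bool_conj of_bool_def)
  moreover have "even (card (neighbours G x \<inter> neighbours G y))"
  proof (cases "x = y")
    case True
    then show ?thesis using even xy by (simp add: even_degrees_def)
  qed (use common xy False in blast)
  ultimately show ?thesis
    using False by (auto simp: rosenstiehl_cocycle_def rosenstiehl_form_def adjacency_def elim!: evenE)
qed (simp add: rosenstiehl_cocycle_def)

lemma coboundary_eq_colour_form: "coboundary G (colour_bit \<chi>) = colour_form G \<chi>"
  by (simp add: fun_eq_iff coboundary_def colour_form_eq adjacency_def add.commute)

theorem corollary1p2:
  fixes G :: "'a pair_pre_digraph"
  assumes "chordiagraph G"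
    and "\<forall>x\<in>pverts G. even (card (neighbours G x))"
  shows "(\<forall>C :: 'b list. chord_diagram C \<and> has_interlace_graph C G \<longrightarrow>
            minimal_genus C =
              1 / 2 * real (Min {matrix_rank (pverts G) (rosenstiehl_form G + colour_form G \<chi>) | \<chi>. True}))
    \<and> ((\<forall>x\<in>pverts G. \<forall>y\<in>pverts G. x \<noteq> y \<and> (x, y) \<notin> parcs G \<longrightarrow>
            even (card (neighbours G x \<inter> neighbours G y))) \<longrightarrow>
       (\<forall>C :: 'b list. chord_diagram C \<and> has_interlace_graph C G \<longrightarrow>
            minimal_genus C =
              Min {real (matrix_rank (pverts G) c) / 2 | c. c \<in> (+) (rosenstiehl_cocycle G) ` coboundaries G}))"
proof -
  have G: "pair_graph G" using assms(1) by (simp add: chordiagraph_def)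
  interpret pair_graph G by fact
  have even: "even_degrees G" using assms(2) by (simp add: even_degrees_def)
  have main: "minimal_genus C =
      Min {real (matrix_rank (pverts G) (rosenstiehl_form G + colour_form G \<chi>)) / 2 | \<chi>. True}"
    if C: "chord_diagram C" "has_interlace_graph C G" for C :: "'b list"
  proof -
    obtain f where f: "inj_on f (set C)" "interlace_graph (map f C) = G"
      using has_interlace_graph_relabelling[OF C(2)] .
    then have "pverts G = set (map f C)" by (auto simp: interlace_graph_def)
    then show ?thesis
      using minimal_genus_interlace_graph[OF chord_diagram_map[OF C(1) f(1)]] even f(2)
        minimal_genus_map[OF C(1) f(1)] by simp
  qed
  show ?thesis
  proof (intro conjI impI allI; elim conjE)
    fix C :: "'b list" assume "chord_diagram C" "has_interlace_graph C G"
    then show "minimal_genus C =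
        1 / 2 * real (Min {matrix_rank (pverts G) (rosenstiehl_form G + colour_form G \<chi>) | \<chi>. True})"
      using main Min_half_rank[OF finite_verts, of "\<lambda>\<chi>. rosenstiehl_form G + colour_form G \<chi>"] by simp
  next
    fix C :: "'b list"
    assume common: "\<forall>x\<in>pverts G. \<forall>y\<in>pverts G. x \<noteq> y \<and> (x, y) \<notin> parcs G \<longrightarrow>
        even (card (neighbours G x \<inter> neighbours G y))"
      and C: "chord_diagram C" "has_interlace_graph C G"
    have rank: "matrix_rank (pverts G) (rosenstiehl_cocycle G + coboundary G (colour_bit \<chi>)) =
        matrix_rank (pverts G) (rosenstiehl_form G + colour_form G \<chi>)" for \<chi>
      by (rule matrix_rank_cong)
        (simp add: coboundary_eq_colour_form rosenstiehl_cocycle_eq_form[OF G even common])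
    \<comment> \<open>Every 0-cochain is the indicator of the black vertices of some colouring, so
      the coboundaries are exactly the colour forms.\<close>
    have "coboundaries G = range (\<lambda>\<chi>. coboundary G (colour_bit \<chi>))"
      using Collect_colour_bit[of "coboundary G"] by (simp add: coboundaries_def full_SetCompr_eq)
    then have "{real (matrix_rank (pverts G) c) / 2 | c. c \<in> (+) (rosenstiehl_cocycle G) ` coboundaries G} =
        {real (matrix_rank (pverts G) (rosenstiehl_form G + colour_form G \<chi>)) / 2 | \<chi>. True}"
      using rank by (auto simp: image_iff) metis+
    then show "minimal_genus C =
        Min {real (matrix_rank (pverts G) c) / 2 | c. c \<in> (+) (rosenstiehl_cocycle G) ` coboundaries G}"
      using main[OF C] by simp
  qed
qed

end
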